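(* Let $\mathbf{A}$ be an $n\times n$ real symmetric matrix and $n_{\mathrm{v}}$ a positive integer. Suppose $\mathbf{v}_1,\dots,\mathbf{v}_{n_{\mathrm{v}}}$ are independent and uniformly distributed on the unit sphere $\mathcal{S}^{n-1}$, and set $\Psi_i=\Psi[\mathbf{A},\mathbf{v}_i]$. Then for all $x\in\mathbb{R}$ and $t>0$, $$\mathbb{P}\Big[\Big|\Phi[\mathbf{A}](x)-\tfrac{1}{n_{\mathrm{v}}}\textstyle\sum_{i=1}^{n_{\mathrm{v}}}\Psi_i(x)\Big|>t\Big]\le 2\exp\!\big(-n_{\mathrm{v}}(n+2)t^2\big),$$ and $$\mathbb{P}\Big[d_{\mathrm{KS}}\Big(\Phi[\mathbf{A}],\tfrac{1}{n_{\mathrm{v}}}\textstyle\sum_{i=1}^{n_{\mathrm{v}}}\Psi_i\Big)>t\Big]\le 2n\exp\!\big(-n_{\mathrm{v}}(n+2)t^2\big).$$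
   Context: For a symmetric matrix $\mathbf{A}$ and $x\in\mathbb{R}$, $\mathbb{1}[\mathbf{A}\le x]$ denotes the orthogonal projector onto the span of eigenvectors of $\mathbf{A}$ with eigenvalues $\le x$. The CESM is $\Phi[\mathbf{A}](x)=\frac1n\#\{i:\lambda_i[\mathbf{A}]\le x\}$, and the weighted CESM for a unit vector $\mathbf{v}$ is $\Psi[\mathbf{A},\mathbf{v}](x)=\mathbf{v}^{\mathsf T}\mathbb{1}[\mathbf{A}\le x]\mathbf{v}$. The Kolmogorov–Smirnov distance is $d_{\mathrm{KS}}(\mu,\nu)=\sup_x|\mu(x)-\nu(x)|$. *)

theory Defs
  imports "HOL-Probability.Probability" "HOL-Computational_Algebra.Polynomial"
begin

definition charpoly :: "real^'n^'n \<Rightarrow> real poly" where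
  "charpoly A = det (\<chi> i j. (if i = j then [:0, 1:] else 0) - [:A $ i $ j:])"

definition CESM :: "real^'n^'n \<Rightarrow> real \<Rightarrow> real" where
  "CESM A x = (\<Sum>\<mu>\<in>{\<mu>. poly (charpoly A) \<mu> = 0 \<and> \<mu> \<le> x}. real (order \<mu> (charpoly A)))
               / real CARD('n)"

definition orth_proj :: "(real^'n) set \<Rightarrow> real^'n \<Rightarrow> real^'n" where
  "orth_proj S w = (THE p. p \<in> S \<and> (\<forall>s\<in>S. (w - p) \<bullet> s = 0))"

text \<open>Span of the eigenvectors of A with eigenvalue \<le> x; 1[A \<le> x] is the orthogonal projector onto it.\<close>
definition low_eigenspace :: "real^'n^'n \<Rightarrow> real \<Rightarrow> (real^'n) set" where
  "low_eigenspace A x = span {v. \<exists>\<mu>. \<mu> \<le> x \<and> A *v v = \<mu> *\<^sub>R v}"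

definition spec_proj :: "real^'n^'n \<Rightarrow> real \<Rightarrow> real^'n \<Rightarrow> real^'n" where
  "spec_proj A x = orth_proj (low_eigenspace A x)"

definition wCESM :: "real^'n^'n \<Rightarrow> real^'n \<Rightarrow> real \<Rightarrow> real" where
  "wCESM A v x = v \<bullet> spec_proj A x v"

definition dKS :: "(real \<Rightarrow> real) \<Rightarrow> (real \<Rightarrow> real) \<Rightarrow> real" where
  "dKS F G = (SUP x. \<bar>F x - G x\<bar>)"

text \<open>Uniform (normalised surface) distribution on the unit sphere S^{n-1}: the image of
  the uniform distribution on the unit ball under radial projection v \<mapsto> v/|v|.\<close>
definition unif_sphere :: "(real^'n) measure" where
  "unif_sphere = distr (uniform_measure lborel (ball 0 1)) borel (\<lambda>v. v /\<^sub>R norm v)"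

end

theory Submission
  imports Defs
begin

text \<open>
  Diagonalising A by an orthonormal eigenbasis q with eigenvalues d turns the weighted CESM into
  the sum of (q i \<bullet> v)^2 over all i with d i \<le> x. By rotation invariance this is distributed
  like the sum X of the squares of k coordinates of a uniform point of the sphere, that is,
  Beta(k/2, (n - k)/2), and CESM A x = k/n is its mean.

  Write a = k/2 and c = n/2. The moments m of X satisfy (c + j) m (j+1) = (a + j) m j, so the
  moment generating function M solves Kummer's equation and the logarithmic derivative
  u = M'/M solves x u' = a - c u + x u (1 - u). Since u (1 - u) \<le> 1/4, the derivative
  of x^c (u - a/c - x/(4 (c + 1))) is nonpositive, which gives u \<le> a/c + x/(4 (c + 1)) and,
  after integration, ln (M x) \<le> (a/c) x + x^2/(8 (c + 1)). So X is sub-Gaussian with variance proxy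
  1/(2 (n + 2)), and Chernoff's bound yields the first claim. For the second one, both step
  functions jump only at the at most n eigenvalues, so a union bound suffices.
\<close>

section \<open>Series with the moments of a Beta distribution\<close>

lemma summable_shifted_moments:
  fixes m :: "nat \<Rightarrow> real"
  assumes "\<And>j. \<bar>m j\<bar> \<le> 1"
  shows "summable (\<lambda>j. m (j + r) / fact j * x ^ j)"
proof (rule summable_comparison_test)
  show "summable (\<lambda>j. \<bar>x\<bar> ^ j /\<^sub>R fact j)"
    by (rule summable_exp_generic)
  have "\<bar>m (j + r)\<bar> * (\<bar>x\<bar> ^ j / fact j) \<le> 1 * (\<bar>x\<bar> ^ j / fact j)" for j
    using assms by (intro mult_right_mono) auto
  then show "\<exists>N. \<forall>j\<ge>N. norm (m (j + r) / fact j * x ^ j) \<le> \<bar>x\<bar> ^ j /\<^sub>R fact j"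
    by (simp add: abs_mult power_abs divide_inverse mult_ac)
qed

text \<open>Differentiating an exponential generating series shifts its coefficients by one, so
  \<open>r\<close> counts derivatives.\<close>

lemma DERIV_shifted_moments:
  fixes m :: "nat \<Rightarrow> real"
  assumes "\<And>j. \<bar>m j\<bar> \<le> 1"
  shows "((\<lambda>x. \<Sum>j. m (j + r) / fact j * x ^ j) has_real_derivative
           (\<Sum>j. m (j + Suc r) / fact j * x ^ j)) (at x)"
proof -
  have "diffs (\<lambda>j. m (j + r) / fact j) = (\<lambda>j. m (j + Suc r) / fact j)"
    by (auto simp: diffs_def fun_eq_iff divide_simps)
  then show ?thesis
    using termdiffs_strong_converges_everywhere[OF summable_shifted_moments[of m r, OF assms]] by simp
qed

text \<open>Compare coefficients of x^j / j!: multiplying the derivative of order r + 1 by x gives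
  the coefficient j m(j + r). What is left is (c + j) m(j + 1) - (a + j) m(j), which vanishes by
  \<open>rec\<close>.\<close>

lemma kummer_equation:
  fixes m :: "nat \<Rightarrow> real"
  assumes bnd: "\<And>j. \<bar>m j\<bar> \<le> 1"
    and rec: "\<And>j. (c + real j) * m (Suc j) = (a + real j) * m j"
  defines "p \<equiv> \<lambda>r x. \<Sum>j. m (j + r) / fact j * x ^ j"
  shows "x * p 2 x + (c - x) * p 1 x = a * p 0 x"
proof -
  have sums: "(\<lambda>j. m (j + r) / fact j * x ^ j) sums p r x" for r
    unfolding p_def using summable_shifted_moments[of m r x, OF bnd] by (rule summable_sums)
  have shift: "(\<lambda>j. real j * (m (j + r) / fact j * x ^ j)) sums (x * p (Suc r) x)" for r
  proof -
    \<comment> \<open>Multiplication by x moves the series up by one index; the new term at index 0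
      is zero because of the factor \<open>real j\<close>.\<close>
    have "(\<lambda>j. x * (m (j + Suc r) / fact j * x ^ j)) sums (x * p (Suc r) x)"
      by (intro sums_mult sums)
    also have "(\<lambda>j. x * (m (j + Suc r) / fact j * x ^ j))
        = (\<lambda>j. real (Suc j) * (m (Suc j + r) / fact (Suc j) * x ^ Suc j))"
      by (auto simp: fun_eq_iff divide_simps)
    finally show ?thesis
      by (subst (asm) sums_Suc_iff) simp
  qed
  have "(\<lambda>j. (real j * (m (j + 1) / fact j * x ^ j) + c * (m (j + 1) / fact j * x ^ j))
        - (real j * (m (j + 0) / fact j * x ^ j) + a * (m (j + 0) / fact j * x ^ j)))
      sums ((x * p (Suc 1) x + c * p 1 x) - (x * p (Suc 0) x + a * p 0 x))"
    by (intro sums_diff sums_add sums_mult sums shift)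
  moreover have "(real j * (m (j + 1) / fact j * x ^ j) + c * (m (j + 1) / fact j * x ^ j))
        - (real j * (m (j + 0) / fact j * x ^ j) + a * (m (j + 0) / fact j * x ^ j)) = 0" for j
  proof -
    have "(real j * (m (j + 1) / fact j * x ^ j) + c * (m (j + 1) / fact j * x ^ j))
        - (real j * (m (j + 0) / fact j * x ^ j) + a * (m (j + 0) / fact j * x ^ j))
      = ((c + real j) * m (Suc j) - (a + real j) * m j) * (x ^ j / fact j)"
      by (simp add: algebra_simps add_divide_distrib diff_divide_distrib)
    then show ?thesis using rec by simp
  qed
  ultimately have "(x * p (Suc 1) x + c * p 1 x) - (x * p (Suc 0) x + a * p 0 x) = 0"
    by (metis (no_types, lifting) sums_0 sums_unique2)
  then show ?thesis by (simp add: algebra_simps numeral_2_eq_2)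
qed

lemma kummer_series_le_gaussian:
  fixes m :: "nat \<Rightarrow> real"
  assumes m0: "m 0 = 1" and nonneg: "\<And>j. 0 \<le> m j" and le1: "\<And>j. m j \<le> 1"
    and rec: "\<And>j. (c + real j) * m (Suc j) = (a + real j) * m j"
    and c: "c > 0" and b: "b \<ge> 0"
  shows "(\<Sum>j. m j / fact j * b ^ j) \<le> exp (a / c * b + b\<^sup>2 / (8 * (c + 1)))"
proof -
  have bnd: "\<bar>m j\<bar> \<le> 1" for j using nonneg[of j] le1[of j] by auto
  define p where "p r x = (\<Sum>j. m (j + r) / fact j * x ^ j)" for r x
  have ode: "x * p 2 x + (c - x) * p 1 x = a * p 0 x" for x
    unfolding p_def by (rule kummer_equation[OF bnd rec])
  have p': "(p r has_real_derivative p (Suc r) x) (at x)" for r x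
    unfolding p_def[abs_def] by (rule DERIV_shifted_moments[OF bnd])
  have pos: "p 0 x > 0" if "x \<ge> 0" for x
  proof -
    \<comment> \<open>For x \<ge> 0 all terms are nonnegative, and the term of index 0 is
      \<open>m 0 = 1\<close>.\<close>
    have "(\<Sum>j\<in>{0}. m (j + 0) / fact j * x ^ j) \<le> p 0 x"
      unfolding p_def using nonneg that
      by (intro sum_le_suminf summable_shifted_moments[OF bnd]) auto
    then show ?thesis using m0 by simp
  qed
  define u where "u x = p 1 x / p 0 x" for x
  define u1 where "u1 x = (p 2 x * p 0 x - p 1 x * p 1 x) / (p 0 x * p 0 x)" for x
  have u': "(u has_real_derivative u1 x) (at x)" if "x \<ge> 0" for x
    unfolding u_def[abs_def] u1_def using pos[OF that] p'[of 0 x] p'[of 1 x]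
    by (auto intro!: derivative_eq_intros simp: numeral_2_eq_2)
  have riccati: "x * u1 x = a - c * u x + x * u x - x * (u x)\<^sup>2" if "x \<ge> 0" for x
  proof -
    have "x * u1 x = (x * p 2 x) / p 0 x - x * (u x)\<^sup>2"
      using pos[OF that] unfolding u_def u1_def
      by (simp add: power2_eq_square diff_divide_distrib right_diff_distrib)
    also have "x * p 2 x = a * p 0 x - (c - x) * p 1 x" using ode[of x] by simp
    also have "\<dots> / p 0 x = a - (c - x) * u x"
      using pos[OF that] unfolding u_def by (simp add: diff_divide_distrib)
    finally show ?thesis by (simp add: algebra_simps)
  qed
  \<comment> \<open>Since 1/4 is the maximum of u (1 - u), \<open>e\<close> is chosen with c/e + 1/e
    = 1/4. This completes the square in the derivative of \<open>W\<close> below.\<close>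
  define e where "e = 4 * (c + 1)"
  have e: "e > 0" "c / e + 1 / e = 1 / 4" using c by (auto simp: e_def divide_simps)
  have u_le: "u x \<le> a / c + x / e" if x: "x > 0" for x
  proof -
    \<comment> \<open>The power y^c is the integrating factor for the linear term - c u of the
      Riccati equation. It also forces \<open>W 0 = 0\<close>, so monotonicity alone gives the sign
      at x.\<close>
    define W where "W y = y powr c * (u y - a / c - y / e)" for y
    have "W x \<le> W 0"
    proof (rule DERIV_nonpos_imp_decreasing_open[of 0 x W])
      show "continuous_on {0..x} W"
      proof -
        have "continuous_on {0..x} u"
          by (rule DERIV_continuous_on[where D = u1]) (auto intro!: has_field_derivative_at_within u')
        then show ?thesis unfolding W_def[abs_def] using c e
          by (intro continuous_intros continuous_on_powr') auto
      qed
      fix y assume y: "0 < y" "y < x"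
      have "((\<lambda>y. y powr c) has_real_derivative c * y powr (c - 1)) (at y)"
        using y by (intro has_real_derivative_powr) auto
      moreover have "((\<lambda>y. u y - a / c - y / e) has_real_derivative u1 y - 1 / e) (at y)"
        using y e by (auto intro!: derivative_eq_intros u')
      ultimately have "(W has_real_derivative c * y powr (c - 1) * (u y - a / c - y / e)
          + (u1 y - 1 / e) * y powr c) (at y)"
        unfolding W_def[abs_def] by (rule DERIV_mult)
      moreover have "c * y powr (c - 1) * (u y - a / c - y / e) + (u1 y - 1 / e) * y powr c
          = - (y powr (c - 1) * (y * (u y - 1/2)\<^sup>2))"
      proof -
        have "c * (u y - a / c - y / e) + (u1 y - 1 / e) * y
            = c * u y - a + y * u1 y - (c / e + 1 / e) * y"
          using c by (simp add: algebra_simps)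
        also have "\<dots> = - (y * (u y - 1/2)\<^sup>2)"
          unfolding e riccati[OF less_imp_le[OF y(1)]] by (simp add: power2_eq_square algebra_simps)
        finally have eq: "c * (u y - a / c - y / e) + (u1 y - 1 / e) * y = - (y * (u y - 1/2)\<^sup>2)" .
        have "y powr c = y powr (c - 1) * y"
          using y by (simp add: powr_diff)
        then have "c * y powr (c - 1) * (u y - a / c - y / e) + (u1 y - 1 / e) * y powr c
            = y powr (c - 1) * (c * (u y - a / c - y / e) + (u1 y - 1 / e) * y)"
          by (simp only: distrib_left mult_ac)
        then show ?thesis unfolding eq by simp
      qed
      moreover have "- (y powr (c - 1) * (y * (u y - 1/2)\<^sup>2)) \<le> 0"
        using y by simp
      ultimately show "\<exists>D. (W has_real_derivative D) (at y) \<and> D \<le> 0"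
        by metis
    qed (use x in simp)
    then have "x powr c * (u x - a / c - x / e) \<le> 0"
      using c by (simp add: W_def)
    then show ?thesis using x by (simp add: mult_le_0_iff)
  qed
  \<comment> \<open>\<open>G\<close> is the claimed exponent minus the logarithm of the series. It
    vanishes at 0, and its derivative is the slack in \<open>u_le\<close>.\<close>
  define G where "G x = a / c * x + x\<^sup>2 / (2 * e) - ln (p 0 x)" for x
  have G': "(G has_real_derivative (a / c + x / e - u x)) (at x)" if "x \<ge> 0" for x
  proof -
    have "((\<lambda>x. ln (p 0 x)) has_real_derivative u x) (at x)"
      using pos[OF that] p'[of 0 x] by (auto intro!: derivative_eq_intros simp: u_def)
    moreover have "((\<lambda>x. a / c * x + x\<^sup>2 / (2 * e)) has_real_derivative (a / c + x / e)) (at x)"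
      using e c by (auto intro!: derivative_eq_intros)
    ultimately show ?thesis unfolding G_def[abs_def] by (intro DERIV_diff)
  qed
  have "G 0 \<le> G b"
  proof (rule DERIV_nonneg_imp_increasing_open[OF b])
    show "\<exists>D. (G has_real_derivative D) (at x) \<and> 0 \<le> D" if "0 < x" "x < b" for x
      using G'[of x] u_le[of x] that
      by (intro exI[of _ "a / c + x / e - u x"]) auto
    show "continuous_on {0..b} G"
      by (rule DERIV_continuous_on[where D = "\<lambda>x. a / c + x / e - u x"])
         (auto intro!: has_field_derivative_at_within G')
  qed
  moreover have "p 0 0 = 1" unfolding p_def using m0 by (subst powser_zero) simp
  ultimately have "ln (p 0 b) \<le> a / c * b + b\<^sup>2 / (2 * e)" by (simp add: G_def)
  then have "p 0 b \<le> exp (a / c * b + b\<^sup>2 / (2 * e))"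
    using pos[OF b] by (metis exp_le_cancel_iff exp_ln)
  then show ?thesis by (simp add: p_def e_def)
qed

section \<open>Spectral decomposition\<close>

lemma symmetric_matrix_inner:
  fixes A :: "real^'n^'n"
  assumes "transpose A = A"
  shows "x \<bullet> (A *v y) = (A *v x) \<bullet> y"
  using assms by (metis dot_lmul_matrix vector_transpose_matrix)

text \<open>Maximise the Rayleigh quotient over the unit sphere of \<open>S\<close>, which is
  compact. At a maximiser the residual A v - \<mu> v, which lies in \<open>S\<close> by invariance,
  must vanish by first-order optimality.\<close>

lemma symmetric_matrix_eigenvector_exists:
  fixes A :: "real^'n^'n"
  assumes sym: "transpose A = A" and S: "subspace S" and inv: "\<And>x. x \<in> S \<Longrightarrow> A *v x \<in> S"
    and S0: "S \<noteq> {0}"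
  obtains v \<mu> where "v \<in> S" "norm v = 1" "A *v v = \<mu> *\<^sub>R v"
proof -
  obtain w where w: "w \<in> S" "w \<noteq> 0" using S0 subspace_0[OF S] by blast
  let ?K = "S \<inter> sphere 0 1"
  have "w /\<^sub>R norm w \<in> ?K" using w S by (auto simp: subspace_mul)
  then have ne: "?K \<noteq> {}" by blast
  have "compact ?K" by (intro closed_Int_compact closed_subspace S) auto
  moreover have "continuous_on ?K (\<lambda>x. x \<bullet> (A *v x))"
    by (intro continuous_on_inner continuous_on_id matrix_vector_mult_linear_continuous_on)
  ultimately obtain v where v: "v \<in> ?K" and max: "\<And>x. x \<in> ?K \<Longrightarrow> x \<bullet> (A *v x) \<le> v \<bullet> (A *v v)"
    using continuous_attains_sup[OF _ ne] by blast
  define \<mu> where "\<mu> = v \<bullet> (A *v v)"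
  have nv: "norm v = 1" "v \<bullet> v = 1" using v by (auto simp: dot_square_norm)
  have rayleigh: "x \<bullet> (A *v x) \<le> \<mu> * (x \<bullet> x)" if x: "x \<in> S" for x
  proof (cases "x = 0")
    case False
    have "(x /\<^sub>R norm x) \<bullet> (A *v (x /\<^sub>R norm x)) \<le> \<mu>"
      unfolding \<mu>_def using x False S by (intro max) (auto simp: subspace_mul)
    then have "(x \<bullet> (A *v x)) / (norm x)\<^sup>2 \<le> \<mu>"
      by (simp add: matrix_vector_mult_scaleR power2_eq_square divide_inverse mult_ac)
    then show ?thesis using False by (simp add: divide_le_eq dot_square_norm)
  qed auto
  define y where "y = A *v v - \<mu> *\<^sub>R v"
  have yS: "y \<in> S" unfolding y_def using v inv S by (auto simp: subspace_diff subspace_mul)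
  have yv: "y \<bullet> v = 0" unfolding y_def using nv
    by (simp add: inner_diff_left \<mu>_def inner_commute[of "A *v v" v])
  have "y \<bullet> y = y \<bullet> (A *v v) - \<mu> * (y \<bullet> v)"
    by (subst (2) y_def) (simp add: inner_diff_right)
  then have yAv: "y \<bullet> (A *v v) = y \<bullet> y" using yv by simp
  define C where "C = \<mu> * (y \<bullet> y) - y \<bullet> (A *v y)"
  \<comment> \<open>Apply the Rayleigh bound to the perturbed vector v + t y: the terms free of t
    cancel, and the gain linear in t is 2 t |y|^2.\<close>
  have C: "2 * t * (y \<bullet> y) \<le> t\<^sup>2 * C" for t
  proof -
    have "(v + t *\<^sub>R y) \<bullet> (A *v (v + t *\<^sub>R y)) \<le> \<mu> * ((v + t *\<^sub>R y) \<bullet> (v + t *\<^sub>R y))"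
      using v yS S by (intro rayleigh) (auto simp: subspace_add subspace_mul)
    moreover have "v \<bullet> (A *v y) = y \<bullet> y"
      using symmetric_matrix_inner[OF sym, of v y] yAv by (simp add: inner_commute)
    ultimately show ?thesis using nv yv yAv
      by (simp add: matrix_vector_right_distrib matrix_vector_mult_scaleR inner_add_left inner_add_right
          \<mu>_def[symmetric] C_def inner_commute[of v y] power2_eq_square algebra_simps)
  qed
  have "y = 0"
  proof (rule ccontr)
    assume "y \<noteq> 0"
    then have yy: "y \<bullet> y > 0" by simp
    have "2 * (y \<bullet> y) \<le> C" using C[of 1] by simp
    then have C0: "C > 0" using yy by linarith
    \<comment> \<open>For this \<open>t\<close> the right-hand side of \<open>C\<close> is half of
      its positive left-hand side.\<close>
    define t where "t = (y \<bullet> y) / C"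
    have t: "t > 0" "t * C = y \<bullet> y" using yy C0 by (auto simp: t_def)
    have "t * (2 * (y \<bullet> y)) \<le> t * (t * C)" using C[of t] by (simp add: power2_eq_square mult_ac)
    then show False using t yy by simp
  qed
  then show ?thesis using that[of v \<mu>] v nv by (simp add: y_def)
qed

text \<open>Induction on the dimension: split off a unit eigenvector. By symmetry of
  \<open>A\<close> its orthogonal complement within \<open>S\<close> is invariant again.\<close>

lemma symmetric_matrix_eigenbasis_subspace:
  fixes A :: "real^'n^'n"
  assumes sym: "transpose A = A" and "subspace S" and "\<And>x. x \<in> S \<Longrightarrow> A *v x \<in> S"
  shows "\<exists>B. B \<subseteq> S \<and> pairwise orthogonal B \<and> (\<forall>v\<in>B. norm v = 1 \<and> (\<exists>\<mu>. A *v v = \<mu> *\<^sub>R v)) \<and> span B = S"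
  using assms(2,3)
proof (induction "dim S" arbitrary: S rule: less_induct)
  case less
  show ?case
  proof (cases "S = {0}")
    case True
    then show ?thesis by (intro exI[of _ "{}"]) (auto simp: pairwise_def)
  next
    case False
    obtain v \<mu> where v: "v \<in> S" "norm v = 1" "A *v v = \<mu> *\<^sub>R v"
      using symmetric_matrix_eigenvector_exists[OF sym less.prems False] by blast
    define T where "T = {x \<in> S. orthogonal v x}"
    have T: "subspace T" unfolding T_def orthogonal_def using less.prems(1)
      by (auto simp: subspace_def inner_add_right)
    have invT: "A *v x \<in> T" if "x \<in> T" for x
      using that less.prems(2) symmetric_matrix_inner[OF sym, of v x] v
      by (auto simp: T_def orthogonal_def)
    have "v \<notin> T" using v by (auto simp: T_def orthogonal_def)
    then have "T \<subset> S" using v by (auto simp: T_def)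
    then have "dim T < dim S"
      using dim_psubset[of T S] T less.prems(1) by (simp add: span_eq_iff[THEN iffD2])
    from less.hyps[OF this T invT] obtain B where B: "B \<subseteq> T" "pairwise orthogonal B"
      "\<forall>v\<in>B. norm v = 1 \<and> (\<exists>\<mu>. A *v v = \<mu> *\<^sub>R v)" "span B = T" by auto
    show ?thesis
    proof (intro exI[of _ "insert v B"] conjI)
      show "insert v B \<subseteq> S" using B v by (auto simp: T_def)
      show "pairwise orthogonal (insert v B)"
        using B by (auto simp: pairwise_insert T_def orthogonal_commute)
      show "\<forall>v\<in>insert v B. norm v = 1 \<and> (\<exists>\<mu>. A *v v = \<mu> *\<^sub>R v)" using B v by auto
      show "span (insert v B) = S"
      proof
        show "span (insert v B) \<subseteq> S"
          using B v less.prems(1) by (intro span_minimal) (auto simp: T_def)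
        show "S \<subseteq> span (insert v B)"
        proof
          fix x assume x: "x \<in> S"
          have "x - (v \<bullet> x) *\<^sub>R v \<in> T"
            using x v less.prems(1)
            by (auto simp: T_def orthogonal_def inner_diff_right subspace_diff subspace_mul dot_square_norm)
          then show "x \<in> span (insert v B)" using B(4) by (auto simp: span_insert)
        qed
      qed
    qed
  qed
qed

lemma symmetric_matrix_eigenbasis:
  fixes A :: "real^'n^'n"
  assumes sym: "transpose A = A"
  obtains q :: "'n \<Rightarrow> real^'n" and d :: "'n \<Rightarrow> real"
  where "\<And>i j. q i \<bullet> q j = (if i = j then 1 else 0)" "\<And>i. A *v q i = d i *\<^sub>R q i"
proof -
  obtain B where B: "pairwise orthogonal B"
      "\<forall>v\<in>B. norm v = 1 \<and> (\<exists>\<mu>. A *v v = \<mu> *\<^sub>R v)" "span B = (UNIV :: (real^'n) set)"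
    using symmetric_matrix_eigenbasis_subspace[OF sym, of UNIV] by auto
  \<comment> \<open>Nonzero orthogonal vectors are independent, so \<open>B\<close> has exactly n
    elements and can be indexed by the type \<open>'n\<close>.\<close>
  have "0 \<notin> B" using B(2) by fastforce
  then have ind: "independent B" using B(1) pairwise_orthogonal_independent by blast
  then have "card B = CARD('n)"
    using B(3) dim_eq_card_independent[OF ind] dim_span[of B] by simp
  then obtain q where q: "bij_betw q (UNIV :: 'n set) B"
    by (metis finite_class.finite_UNIV finite_same_card_bij finiteI_independent ind)
  then have qB: "q i \<in> B" for i by (auto simp: bij_betw_def)
  then have "\<exists>\<mu>. A *v q i = \<mu> *\<^sub>R q i" for i using B(2) by auto
  then obtain d where "\<And>i. A *v q i = d i *\<^sub>R q i" by metis
  moreover have "q i \<bullet> q j = (if i = j then 1 else 0)" for i j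
  proof (cases "i = j")
    case True
    then show ?thesis using B(2) qB[of j] by (simp add: dot_square_norm)
  next
    case False
    then have "q i \<noteq> q j" using q by (auto simp: bij_betw_def inj_on_def)
    then show ?thesis using B(1) qB[of i] qB[of j] False by (auto simp: pairwise_def orthogonal_def)
  qed
  ultimately show ?thesis using that by blast
qed

text \<open>The square matrix with rows \<open>q i\<close> is orthogonal, and the expansion is Q^T
  (Q x) = x written out in coordinates.\<close>

lemma orthonormal_family_expansion:
  fixes q :: "'n \<Rightarrow> real^'n"
  assumes q: "\<And>i j. q i \<bullet> q j = (if i = j then 1 else 0)"
  shows "(\<Sum>i\<in>UNIV. (q i \<bullet> x) *\<^sub>R q i) = x"
proof -
  define Q :: "real^'n^'n" where "Q = (\<chi> i j. q i $ j)"
  have row: "row i Q = q i" for i by (simp add: Q_def row_def vec_eq_iff)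
  have "orthogonal_matrix Q"
    unfolding orthogonal_matrix_orthonormal_rows using q
    by (auto simp: row orthogonal_def norm_eq_sqrt_inner)
  then have "transpose Q *v (Q *v x) = x"
    by (simp add: matrix_vector_mul_assoc orthogonal_matrix_def)
  moreover have "Q *v x = (\<chi> i. q i \<bullet> x)"
    by (simp add: vec_eq_iff matrix_vector_mul_component Q_def)
  ultimately show ?thesis
    by (auto simp: vec_eq_iff matrix_vector_mult_def transpose_def Q_def mult.commute)
qed

lemma orthonormal_family_parseval:
  fixes q :: "'n \<Rightarrow> real^'n"
  assumes q: "\<And>i j. q i \<bullet> q j = (if i = j then 1 else 0)"
  shows "(\<Sum>i\<in>UNIV. (q i \<bullet> x)\<^sup>2) = (norm x)\<^sup>2"
proof -
  have "(norm x)\<^sup>2 = (\<Sum>i\<in>UNIV. (q i \<bullet> x) *\<^sub>R q i) \<bullet> x"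
    by (simp add: orthonormal_family_expansion[OF q] dot_square_norm)
  then show ?thesis by (simp add: inner_sum_left power2_eq_square)
qed

section \<open>The characteristic polynomial, and the CESM as a count of eigenvalues\<close>

lemma charpoly_eq_prod_eigenvalues:
  fixes A :: "real^'n^'n" and q :: "'n \<Rightarrow> real^'n"
  assumes q: "\<And>i j. q i \<bullet> q j = (if i = j then 1 else 0)" and d: "\<And>i. A *v q i = d i *\<^sub>R q i"
  shows "charpoly A = (\<Prod>i\<in>UNIV. [:- d i, 1:])"
proof -
  define C :: "real poly^'n^'n" where "C = (\<chi> i j. (if i = j then [:0, 1:] else 0) - [:A $ i $ j:])"
  define Q :: "real poly^'n^'n" where "Q = (\<chi> i j. [:q j $ i:])"
  define D :: "real poly^'n^'n" where "D = (\<chi> i j. if i = j then [:- d i, 1:] else 0)"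
  have sum_pCons: "(\<Sum>k\<in>K. [:f k:]) = [:\<Sum>k\<in>K. f k:]" for f :: "'n \<Rightarrow> real" and K
    by (induction K rule: infinite_finite_induct) auto
  have "(\<Sum>k\<in>UNIV. A $ i $ k * q j $ k) = d j * q j $ i" for i j
    using arg_cong[OF d[of j], of "\<lambda>v. v $ i"] by (simp add: matrix_vector_mult_def)
  then have AQ: "(\<Sum>k\<in>UNIV. [:A $ i $ k:] * Q $ k $ j) = [:d j * q j $ i:]" for i j
    by (simp add: Q_def sum_pCons mult.commute)
  \<comment> \<open>Over the polynomial ring this is (X - A) Q = Q diag(X - d j). After taking
    determinants, det Q is cancelled, as real polynomials have no zero divisors.\<close>
  have "(C ** Q) $ i $ j = (Q ** D) $ i $ j" for i j
  proof -
    have "(C ** Q) $ i $ j = (\<Sum>k\<in>UNIV. (if i = k then [:0, 1:] * Q $ k $ j else 0)) - [:d j * q j $ i:]"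
      unfolding AQ[symmetric] sum_subtractf[symmetric]
      by (auto simp: matrix_matrix_mult_def C_def left_diff_distrib intro!: sum.cong)
    also have "\<dots> = [:0, 1:] * [:q j $ i:] - [:d j * q j $ i:]" by (simp add: Q_def)
    also have "\<dots> = (\<Sum>k\<in>UNIV. (if k = j then Q $ i $ k * [:- d k, 1:] else 0))"
      by (simp add: Q_def)
    also have "\<dots> = (Q ** D) $ i $ j"
      unfolding matrix_matrix_mult_def D_def vec_lambda_beta by (intro sum.cong) auto
    finally show ?thesis .
  qed
  then have "C ** Q = Q ** D" by (simp add: vec_eq_iff)
  then have "det C * det Q = det Q * det D" by (metis det_mul)
  moreover have "det Q \<noteq> 0"
  proof -
    have "(\<Sum>k\<in>UNIV. q i $ k * q j $ k) = (if i = j then 1 else 0)" for i j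
      using q[of i j] by (simp add: inner_vec_def)
    then have "transpose Q ** Q = mat 1"
      by (auto simp: vec_eq_iff matrix_matrix_mult_def transpose_def Q_def mat_def sum_pCons)
    then have "det (transpose Q) * det Q = 1" by (metis det_I det_mul)
    then show ?thesis by auto
  qed
  ultimately have "det C = det D" by simp
  also have "\<dots> = (\<Prod>i\<in>UNIV. [:- d i, 1:])" by (subst det_diagonal) (auto simp: D_def)
  finally show ?thesis by (simp add: charpoly_def C_def)
qed

lemma order_prod_linear_factors:
  fixes d :: "'i \<Rightarrow> 'a::idom"
  assumes "finite K"
  shows "order \<mu> (\<Prod>i\<in>K. [:- d i, 1:]) = card {i\<in>K. d i = \<mu>}"
  using assms
proof (induction K)
  case (insert k K)
  have "(\<Prod>i\<in>K. [:- d i, 1:]) \<noteq> 0" using insert by auto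
  then have "order \<mu> (\<Prod>i\<in>insert k K. [:- d i, 1:])
      = order \<mu> [:- d k, 1:] + card {i\<in>K. d i = \<mu>}"
    using insert by (simp add: order_mult del: mult_pCons_left)
  also have "order \<mu> [:- d k, 1:] = (if d k = \<mu> then 1 else 0)"
    using order_power_n_n[of \<mu> 1] by (auto simp: order_0I)
  also have "\<dots> + card {i\<in>K. d i = \<mu>} = card {i\<in>insert k K. d i = \<mu>}"
  proof (cases "d k = \<mu>")
    case True
    then have "{i\<in>insert k K. d i = \<mu>} = insert k {i\<in>K. d i = \<mu>}" by auto
    then show ?thesis using insert True by simp
  next
    case False
    then have "{i\<in>insert k K. d i = \<mu>} = {i\<in>K. d i = \<mu>}" by auto
    then show ?thesis using False by simp
  qed
  finally show ?case .
qed auto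

text \<open>The multiplicity of a root is the size of the fibre of \<open>d\<close> over it, and the
  fibres over the values at most \<open>x\<close> partition the indices counted on the
  right.\<close>

lemma CESM_eq_card_eigenvalues:
  fixes A :: "real^'n^'n" and q :: "'n \<Rightarrow> real^'n"
  assumes q: "\<And>i j. q i \<bullet> q j = (if i = j then 1 else 0)" and d: "\<And>i. A *v q i = d i *\<^sub>R q i"
  shows "CESM A x = real (card {i. d i \<le> x}) / real CARD('n)"
proof -
  let ?R = "d ` {i. d i \<le> x}"
  have roots: "{\<mu>. poly (charpoly A) \<mu> = 0 \<and> \<mu> \<le> x} = ?R"
    by (auto simp: charpoly_eq_prod_eigenvalues[OF q d] poly_prod image_iff)
  have "card {i. d i \<le> x} = (\<Sum>\<mu>\<in>?R. card {i. d i = \<mu>})"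
  proof -
    have "card {i. d i \<le> x} = card (\<Union>\<mu>\<in>?R. {i. d i = \<mu>})"
      by (rule arg_cong[of _ _ card]) auto
    also have "\<dots> = (\<Sum>\<mu>\<in>?R. card {i. d i = \<mu>})"
      by (rule card_UN_disjoint) auto
    finally show ?thesis .
  qed
  then show ?thesis
    unfolding CESM_def roots
    by (simp add: charpoly_eq_prod_eigenvalues[OF q d] order_prod_linear_factors)
qed

section \<open>The spectral projector and the weighted CESM in an eigenbasis\<close>

lemma orth_proj_eqI:
  fixes p w :: "real^'n"
  assumes S: "subspace S" and p: "p \<in> S" "\<And>s. s \<in> S \<Longrightarrow> (w - p) \<bullet> s = 0"
  shows "orth_proj S w = p"
  unfolding orth_proj_def
proof (rule the_equality)
  fix p' assume p': "p' \<in> S \<and> (\<forall>s\<in>S. (w - p') \<bullet> s = 0)"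
  \<comment> \<open>Two candidates differ by a vector of \<open>S\<close> that is orthogonal to all
    of \<open>S\<close>, hence to itself.\<close>
  have "p - p' \<in> S" using p p' S by (simp add: subspace_diff)
  then have "(w - p') \<bullet> (p - p') - (w - p) \<bullet> (p - p') = 0" using p p' by simp
  then have "(p - p') \<bullet> (p - p') = 0" by (simp add: inner_diff_left algebra_simps)
  then show "p' = p" by simp
qed (use p in auto)

text \<open>By symmetry of \<open>A\<close>, an eigenvector for \<mu> is orthogonal to every
  \<open>q i\<close> with d i different from \<mu>. Its expansion in the eigenbasis therefore only
  involves indices with d i \<le> x.\<close>

lemma low_eigenspace_eq_span_eigenbasis:
  fixes A :: "real^'n^'n" and q :: "'n \<Rightarrow> real^'n"
  assumes sym: "transpose A = A"
    and q: "\<And>i j. q i \<bullet> q j = (if i = j then 1 else 0)" and d: "\<And>i. A *v q i = d i *\<^sub>R q i"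
  shows "low_eigenspace A x = span (q ` {i. d i \<le> x})"
  unfolding low_eigenspace_def
proof
  show "span (q ` {i. d i \<le> x}) \<subseteq> span {v. \<exists>\<mu>. \<mu> \<le> x \<and> A *v v = \<mu> *\<^sub>R v}"
    using d by (intro span_mono) auto
  show "span {v. \<exists>\<mu>. \<mu> \<le> x \<and> A *v v = \<mu> *\<^sub>R v} \<subseteq> span (q ` {i. d i \<le> x})"
  proof (rule span_minimal)
    show "{v. \<exists>\<mu>. \<mu> \<le> x \<and> A *v v = \<mu> *\<^sub>R v} \<subseteq> span (q ` {i. d i \<le> x})"
    proof clarify
      fix v \<mu> assume v: "\<mu> \<le> x" "A *v v = \<mu> *\<^sub>R v"
      have "q i \<bullet> v = 0 \<or> d i \<le> x" for i
      proof -
        have "\<mu> * (q i \<bullet> v) = d i * (q i \<bullet> v)"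
          using symmetric_matrix_inner[OF sym, of "q i" v] v(2) d[of i] by simp
        then show ?thesis using v(1) by auto
      qed
      then have "(q i \<bullet> v) *\<^sub>R q i \<in> span (q ` {i. d i \<le> x})" for i
        by (metis (mono_tags, lifting) imageI mem_Collect_eq scaleR_zero_left span_base span_mul span_zero)
      then have "(\<Sum>i\<in>UNIV. (q i \<bullet> v) *\<^sub>R q i) \<in> span (q ` {i. d i \<le> x})"
        by (intro span_sum)
      then show "v \<in> span (q ` {i. d i \<le> x})"
        by (simp add: orthonormal_family_expansion[OF q])
    qed
  qed simp
qed

text \<open>The projection keeps the components of \<open>v\<close> along the \<open>q i\<close>
  with d i \<le> x, and pairing it with \<open>v\<close> squares them.\<close>

lemma wCESM_eq_sum_eigenbasis:
  fixes A :: "real^'n^'n" and q :: "'n \<Rightarrow> real^'n"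
  assumes sym: "transpose A = A"
    and q: "\<And>i j. q i \<bullet> q j = (if i = j then 1 else 0)" and d: "\<And>i. A *v q i = d i *\<^sub>R q i"
  shows "wCESM A v x = (\<Sum>i\<in>{i. d i \<le> x}. (q i \<bullet> v)\<^sup>2)"
proof -
  let ?I = "{i. d i \<le> x}"
  have "spec_proj A x v = (\<Sum>i\<in>?I. (q i \<bullet> v) *\<^sub>R q i)"
    unfolding spec_proj_def low_eigenspace_eq_span_eigenbasis[OF sym q d]
  proof (rule orth_proj_eqI)
    show "(\<Sum>i\<in>?I. (q i \<bullet> v) *\<^sub>R q i) \<in> span (q ` ?I)"
      by (intro span_sum span_mul span_base) auto
    fix s assume "s \<in> span (q ` ?I)"
    then show "(v - (\<Sum>i\<in>?I. (q i \<bullet> v) *\<^sub>R q i)) \<bullet> s = 0"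
    proof (induction rule: span_induct)
      case base
      then show ?case by (auto simp: subspace_def inner_add_right)
    next
      case (step s)
      then show ?case
        by (auto simp: inner_diff_left inner_sum_left q if_distrib inner_commute[of v] cong: if_cong)
    qed
  qed simp
  then show ?thesis
    by (simp add: wCESM_def inner_sum_right power2_eq_square inner_commute)
qed

section \<open>The uniform distribution on the sphere\<close>

lemma measurable_ball [measurable]: "ball (c :: 'a::euclidean_space) r \<in> sets borel"
  by simp

lemma unit_ball_emeasure:
  "emeasure lborel (ball 0 1 :: 'a::euclidean_space set) \<noteq> 0"
  "emeasure lborel (ball 0 1 :: 'a::euclidean_space set) \<noteq> \<top>"
  using unit_ball_vol_pos[of "real DIM('a)"] by (auto simp: emeasure_ball less_le)

section \<open>Lebesgue integrals under translations, rotations and coordinate scalings\<close>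

lemma nn_integral_lborel_translation:
  fixes f :: "'a::euclidean_space \<Rightarrow> ennreal"
  assumes [measurable]: "f \<in> borel_measurable borel"
  shows "(\<integral>\<^sup>+x. f (c + x) \<partial>lborel) = (\<integral>\<^sup>+x. f x \<partial>lborel)"
proof -
  have "(\<integral>\<^sup>+x. f x \<partial>lborel) = (\<integral>\<^sup>+x. f x \<partial>distr lborel borel ((+) c))"
    by (simp add: lborel_distr_plus)
  then show ?thesis by (simp add: nn_integral_distr)
qed

text \<open>
  The Fubini argument for uniqueness of translation-invariant measures, applied to Lebesgue measure
  and its image under R, which agree on the unit ball.
\<close>

lemma nn_integral_lborel_orthogonal_transformation:
  fixes R :: "'a::euclidean_space \<Rightarrow> 'a" and f :: "'a \<Rightarrow> ennreal"
  assumes R: "orthogonal_transformation R" and f[measurable]: "f \<in> borel_measurable borel"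
  shows "(\<integral>\<^sup>+x. f (R x) \<partial>lborel) = (\<integral>\<^sup>+x. f x \<partial>lborel)"
proof -
  have lin: "linear R" and norm_R: "norm (R x) = norm x" for x
    using R by (auto simp: orthogonal_transformation)
  have [measurable]: "R \<in> borel_measurable borel"
    using lin by (intro borel_measurable_continuous_onI linear_continuous_on) (simp add: linear_linear)
  define g :: "'a \<Rightarrow> ennreal" where "g = indicator (ball 0 1)"
  have [measurable]: "g \<in> borel_measurable borel" by (simp add: g_def)
  have "(\<integral>\<^sup>+x. f (R x) \<partial>lborel) * (\<integral>\<^sup>+y. g y \<partial>lborel)
      = (\<integral>\<^sup>+x. (\<integral>\<^sup>+y. f (R x) * g (- R x + y) \<partial>lborel) \<partial>lborel)"
    by (simp add: nn_integral_cmult nn_integral_multc nn_integral_lborel_translation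
        del: uminus_add_conv_diff)
  also have "\<dots> = (\<integral>\<^sup>+y. (\<integral>\<^sup>+x. f (R x) * g (- R x + y) \<partial>lborel) \<partial>lborel)"
    by (rule lborel_pair.Fubini') measurable
  also have "\<dots> = (\<integral>\<^sup>+y. (\<integral>\<^sup>+x. f (y + R x) * g (- R x) \<partial>lborel) \<partial>lborel)"
  proof (rule nn_integral_cong)
    fix y :: 'a
    \<comment> \<open>Since \<open>R\<close> is onto, translating x by a preimage of y turns R x
      into y + R x and removes y from the argument of \<open>g\<close>.\<close>
    obtain z where z: "R z = y"
      using orthogonal_transformation_surj[OF R] by (metis surj_def)
    have "(\<integral>\<^sup>+x. f (R x) * g (- R x + y) \<partial>lborel) = (\<integral>\<^sup>+x. f (R (z + x)) * g (- R (z + x) + y) \<partial>lborel)"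
      by (rule nn_integral_lborel_translation[symmetric]) measurable
    then show "(\<integral>\<^sup>+x. f (R x) * g (- R x + y) \<partial>lborel) = (\<integral>\<^sup>+x. f (y + R x) * g (- R x) \<partial>lborel)"
      by (simp add: linear_add[OF lin] z)
  qed
  also have "\<dots> = (\<integral>\<^sup>+x. (\<integral>\<^sup>+y. f (y + R x) * g (- R x) \<partial>lborel) \<partial>lborel)"
    by (rule lborel_pair.Fubini') measurable
  also have "\<dots> = (\<integral>\<^sup>+x. (\<integral>\<^sup>+y. f (R x + y) \<partial>lborel) * g (- R x) \<partial>lborel)"
    by (simp add: nn_integral_multc add.commute)
  also have "\<dots> = (\<integral>\<^sup>+x. f x \<partial>lborel) * (\<integral>\<^sup>+x. g (- R x) \<partial>lborel)"
    by (simp add: nn_integral_lborel_translation nn_integral_cmult)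
  \<comment> \<open>\<open>g\<close> depends only on the norm, which \<open>R\<close> preserves. The
    same ball volume thus appears on both sides and cancels, being finite and nonzero.\<close>
  also have "(\<lambda>x. g (- R x)) = g"
    by (auto simp: g_def fun_eq_iff indicator_def norm_R)
  finally have "(\<integral>\<^sup>+x. f (R x) \<partial>lborel) * emeasure lborel (ball 0 1 :: 'a set)
      = (\<integral>\<^sup>+x. f x \<partial>lborel) * emeasure lborel (ball 0 1 :: 'a set)"
    by (simp add: g_def)
  then show ?thesis
    using unit_ball_emeasure[where 'a='a] by (metis ennreal_mult_cancel_left mult.commute)
qed

lemma nn_integral_lborel_scale_coordinates:
  fixes f :: "real^'n \<Rightarrow> ennreal"
  assumes [measurable]: "f \<in> borel_measurable borel" and c: "\<And>i. c i \<noteq> 0"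
  shows "(\<integral>\<^sup>+x. f x \<partial>lborel) = ennreal (\<Prod>i\<in>UNIV. \<bar>c i\<bar>) * (\<integral>\<^sup>+x. f (\<chi> i. c i * x $ i) \<partial>lborel)"
proof -
  \<comment> \<open>The scale factors must be indexed by basis vectors; the inner product recovers
    \<open>c i\<close> from \<open>axis i 1\<close>.\<close>
  define c' :: "real^'n \<Rightarrow> real" where "c' b = (\<chi> i. c i) \<bullet> b" for b
  define T :: "real^'n \<Rightarrow> real^'n" where "T x = 0 + (\<Sum>b\<in>Basis. (c' b * (x \<bullet> b)) *\<^sub>R b)" for x
  have Basis: "(Basis :: (real^'n) set) = range (\<lambda>i. axis i 1)"
    by (auto simp: Basis_vec_def)
  have inj: "inj (\<lambda>i::'n. axis i (1::real))" by (auto simp: inj_on_def axis_eq_axis)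
  have c'_axis: "c' (axis i 1) = c i" for i by (simp add: c'_def inner_axis)
  have T: "T x = (\<chi> i. c i * x $ i)" for x
    unfolding T_def Basis sum.reindex[OF inj]
    by (simp add: vec_eq_iff c'_axis inner_axis) (simp add: axis_def if_distrib cong: if_cong)
  have [measurable]: "T \<in> borel_measurable borel" unfolding T_def[abs_def] by measurable
  have "lborel = density (distr lborel borel T) (\<lambda>_. \<Prod>b\<in>Basis. \<bar>c' b\<bar>)"
    unfolding T_def[abs_def] by (rule lborel_affine_euclidean) (auto simp: Basis c'_axis c)
  also have "(\<Prod>b\<in>Basis. \<bar>c' b\<bar>) = (\<Prod>i\<in>UNIV. \<bar>c i\<bar>)"
    unfolding Basis prod.reindex[OF inj] by (simp add: c'_axis)
  finally have "(\<integral>\<^sup>+x. f x \<partial>lborel)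
      = (\<integral>\<^sup>+x. f x \<partial>density (distr lborel borel T) (\<lambda>_. ennreal (\<Prod>i\<in>UNIV. \<bar>c i\<bar>)))"
    by simp
  also have "\<dots> = ennreal (\<Prod>i\<in>UNIV. \<bar>c i\<bar>) * (\<integral>\<^sup>+x. f (T x) \<partial>lborel)"
    by (simp add: nn_integral_density nn_integral_distr nn_integral_cmult)
  finally show ?thesis by (simp add: T)
qed

section \<open>The uniform law on the sphere: support, rotation invariance, polar
  factorisation\<close>

lemma prob_space_unif_sphere: "prob_space (unif_sphere :: (real^'n) measure)"
  unfolding unif_sphere_def using unit_ball_emeasure
  by (intro prob_space.prob_space_distr prob_space_uniform_measure) auto

lemma sets_unif_sphere [measurable_cong]: "sets unif_sphere = sets borel"
  and space_unif_sphere [simp]: "space unif_sphere = UNIV"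
  by (simp_all add: unif_sphere_def)

text \<open>Pulls spherical integrals back to the ball, where the invariances of Lebesgue measure
  apply.\<close>

lemma nn_integral_unif_sphere:
  fixes f :: "real^'n \<Rightarrow> ennreal"
  assumes [measurable]: "f \<in> borel_measurable borel"
  shows "(\<integral>\<^sup>+x. f (x /\<^sub>R norm x) * indicator (ball 0 1) x \<partial>lborel)
    = (\<integral>\<^sup>+v. f v \<partial>unif_sphere) * emeasure lborel (ball 0 1 :: (real^'n) set)"
  using unit_ball_emeasure[where 'a="real^'n"]
  by (simp add: unif_sphere_def nn_integral_distr nn_integral_uniform_measure ennreal_divide_times less_top
      ennreal_times_divide mult_divide_eq_ennreal)

text \<open>Radial projection misses the sphere only at the origin, which it sends to 0, and the
  origin is a null set.\<close>

lemma AE_unif_sphere_norm: "AE v in (unif_sphere :: (real^'n) measure). norm v = 1"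
proof -
  have "AE x in (lborel :: (real^'n) measure). x \<noteq> 0"
    by (rule AE_lborel_singleton)
  then have "AE x in uniform_measure lborel (ball 0 1 :: (real^'n) set). x \<noteq> 0"
    using unit_ball_emeasure by (intro AE_uniform_measureI) auto
  then show ?thesis
    unfolding unif_sphere_def by (subst AE_distr_iff) (auto elim: AE_mp)
qed

text \<open>\<open>R\<close> preserves Lebesgue measure and the unit ball, and it commutes with
  radial projection.\<close>

lemma nn_integral_unif_sphere_orthogonal_transformation:
  fixes R :: "real^'n \<Rightarrow> real^'n" and f :: "real^'n \<Rightarrow> ennreal"
  assumes R: "orthogonal_transformation R" and f[measurable]: "f \<in> borel_measurable borel"
  shows "(\<integral>\<^sup>+v. f (R v) \<partial>unif_sphere) = (\<integral>\<^sup>+v. f v \<partial>unif_sphere)"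
proof -
  have lin: "linear R" and norm_R: "norm (R x) = norm x" for x
    using R by (auto simp: orthogonal_transformation)
  have [measurable]: "R \<in> borel_measurable borel"
    using lin by (intro borel_measurable_continuous_onI linear_continuous_on) (simp add: linear_linear)
  have "(\<integral>\<^sup>+v. f (R v) \<partial>unif_sphere) * emeasure lborel (ball 0 1 :: (real^'n) set)
      = (\<integral>\<^sup>+x. f (R x /\<^sub>R norm (R x)) * indicator (ball 0 1) (R x) \<partial>lborel)"
    by (subst nn_integral_unif_sphere[symmetric])
       (auto simp: norm_R linear_scale[OF lin] indicator_def)
  also have "\<dots> = (\<integral>\<^sup>+x. f (x /\<^sub>R norm x) * indicator (ball 0 1) x \<partial>lborel)"
    by (rule nn_integral_lborel_orthogonal_transformation[OF R]) measurable
  also have "\<dots> = (\<integral>\<^sup>+v. f v \<partial>unif_sphere) * emeasure lborel (ball 0 1 :: (real^'n) set)"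
    by (rule nn_integral_unif_sphere) measurable
  finally show ?thesis
    using unit_ball_emeasure[where 'a="real^'n"] by (metis ennreal_mult_cancel_left mult.commute)
qed

text \<open>Scaling by \<open>r\<close> keeps directions, maps the unit ball onto the ball of radius
  \<open>r\<close> and has Jacobian r^n.\<close>

lemma nn_integral_ball_homogeneous:
  fixes f :: "real^'n \<Rightarrow> ennreal"
  assumes [measurable]: "f \<in> borel_measurable borel" and r: "r > 0"
  shows "(\<integral>\<^sup>+x. f (x /\<^sub>R norm x) * indicator (ball 0 r) x \<partial>lborel)
    = ennreal (r ^ CARD('n)) * emeasure lborel (ball 0 1 :: (real^'n) set) * (\<integral>\<^sup>+v. f v \<partial>unif_sphere)"
proof -
  have "(\<integral>\<^sup>+x. f (x /\<^sub>R norm x) * indicator (ball 0 r) x \<partial>lborel)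
    = ennreal (r ^ CARD('n)) *
      (\<integral>\<^sup>+x. f ((\<chi> i. r * x $ i) /\<^sub>R norm (\<chi> i. r * x $ i)) * indicator (ball 0 r) (\<chi> i. r * x $ i) \<partial>lborel)"
    using r by (subst nn_integral_lborel_scale_coordinates[where c = "\<lambda>_. r"]) auto
  also have "(\<integral>\<^sup>+x. f ((\<chi> i. r * x $ i) /\<^sub>R norm (\<chi> i. r * x $ i)) * indicator (ball 0 r) (\<chi> i. r * x $ i) \<partial>lborel)
     = (\<integral>\<^sup>+x. f (x /\<^sub>R norm x) * indicator (ball 0 1) x \<partial>lborel)"
  proof (rule nn_integral_cong)
    fix x :: "real^'n"
    have scale: "(\<chi> i. r * x $ i) = r *\<^sub>R x" by (simp add: vec_eq_iff)
    have "(r *\<^sub>R x) /\<^sub>R norm (r *\<^sub>R x) = x /\<^sub>R norm x" using r by (simp add: mult.commute)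
    moreover have "r *\<^sub>R x \<in> ball 0 r \<longleftrightarrow> x \<in> ball 0 1" using r by simp
    ultimately show "f ((\<chi> i. r * x $ i) /\<^sub>R norm (\<chi> i. r * x $ i)) * indicator (ball 0 r) (\<chi> i. r * x $ i)
        = f (x /\<^sub>R norm x) * indicator (ball 0 1) x"
      unfolding scale indicator_def by presburger
  qed
  also have "\<dots> = (\<integral>\<^sup>+v. f v \<partial>unif_sphere) * emeasure lborel (ball 0 1 :: (real^'n) set)"
    by (rule nn_integral_unif_sphere) measurable
  finally show ?thesis by (simp only: mult_ac)
qed

text \<open>
  Independence of direction and radius: by homogeneity, the radial distributions of the weight f and
  of the constant weight with the same spherical mean agree on all intervals \<open>{..<r}\<close>.
\<close>

lemma nn_integral_polar:
  fixes f :: "real^'n \<Rightarrow> ennreal" and g :: "real \<Rightarrow> ennreal"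
  assumes f[measurable]: "f \<in> borel_measurable borel" and g[measurable]: "g \<in> borel_measurable borel"
    and fin: "(\<integral>\<^sup>+v. f v \<partial>unif_sphere) \<noteq> \<top>"
  shows "(\<integral>\<^sup>+x. f (x /\<^sub>R norm x) * g (norm x) \<partial>lborel)
    = (\<integral>\<^sup>+v. f v \<partial>unif_sphere) * (\<integral>\<^sup>+x. g (norm x) \<partial>(lborel :: (real^'n) measure))"
proof -
  define F where "F = (\<integral>\<^sup>+v. f v \<partial>(unif_sphere :: (real^'n) measure))"
  \<comment> \<open>\<open>N h\<close> is the law of the radius when Lebesgue measure is weighted by
    \<open>h\<close> of the direction.\<close>
  define N where "N h = distr (density (lborel :: (real^'n) measure) (\<lambda>x. h (x /\<^sub>R norm x))) borel norm"
    for h :: "real^'n \<Rightarrow> ennreal"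
  have N: "emeasure (N h) {..<r} = (if r > 0 then ennreal (r ^ CARD('n)) *
      emeasure lborel (ball 0 1 :: (real^'n) set) * (\<integral>\<^sup>+v. h v \<partial>unif_sphere) else 0)"
    if [measurable]: "h \<in> borel_measurable borel" for h r
  proof -
    have "emeasure (N h) {..<r} = (\<integral>\<^sup>+x. h (x /\<^sub>R norm x) * indicator (ball 0 r) x \<partial>lborel)"
      unfolding N_def
      by (subst emeasure_distr, simp, simp, subst emeasure_density, measurable)
         (auto simp: indicator_def intro!: nn_integral_cong)
    then show ?thesis
      by (cases "r > 0") (simp_all add: nn_integral_ball_homogeneous ball_empty)
  qed
  interpret S: prob_space "unif_sphere :: (real^'n) measure" by (rule prob_space_unif_sphere)
  \<comment> \<open>The sphere has total mass 1, so the constant weight \<open>F\<close> has the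
    same spherical mean as \<open>f\<close>.\<close>
  have const: "(\<integral>\<^sup>+v. F \<partial>(unif_sphere :: (real^'n) measure)) = F"
    using S.emeasure_space_1 by (simp add: nn_integral_const)
  have "N f = N (\<lambda>_. F)"
  proof (rule measure_eqI_generator_eq[where E = "range lessThan" and \<Omega> = UNIV and A = "\<lambda>i. {..<real i}"])
    show "Int_stable (range (lessThan :: real \<Rightarrow> real set))"
    proof -
      have "{..<a} \<inter> {..<b} = {..<min a b}" for a b :: real by auto
      then show ?thesis by (auto simp: Int_stable_def)
    qed
    show "emeasure (N f) X = emeasure (N (\<lambda>_. F)) X" if "X \<in> range lessThan" for X
      using that N[OF f] N[of "\<lambda>_. F"] const by (auto simp: F_def)
    show "sets (N f) = sigma_sets UNIV (range lessThan)" "sets (N (\<lambda>_. F)) = sigma_sets UNIV (range lessThan)"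
      by (simp_all add: N_def borel_Iio)
    show "(\<Union>i. {..<real i}) = UNIV"
      using reals_Archimedean2 by auto
    \<comment> \<open>Uniqueness from a generating pi-system asks for finiteness on an exhausting
      sequence; this is where \<open>fin\<close> enters.\<close>
    show "emeasure (N f) {..<real i} \<noteq> \<infinity>" for i
      using fin unit_ball_emeasure[where 'a="real^'n"] by (auto simp: N ennreal_mult_eq_top_iff)
  qed auto
  then have "(\<integral>\<^sup>+r. g r \<partial>N f) = (\<integral>\<^sup>+r. g r \<partial>N (\<lambda>_. F))" by simp
  then show ?thesis
    unfolding N_def by (simp add: nn_integral_distr nn_integral_density nn_integral_cmult F_def)
qed

section \<open>Moments of squared coordinate norms\<close>

definition coord_sq :: "'n set \<Rightarrow> real^'n \<Rightarrow> real" where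
  "coord_sq I x = (\<Sum>i\<in>I. (x $ i)\<^sup>2)"

text \<open>Up to the factor pi^(n/2) these are, for nonempty \<open>I\<close>, the moments of a
  Gamma variable of shape card I / 2. The Gaussian weight is radial, so it splits off in polar
  coordinates, and it is a product over coordinates. With values in \<open>ennreal\<close> the
  moments make sense before finiteness is known.\<close>

definition gauss_moment :: "'n::finite set \<Rightarrow> nat \<Rightarrow> ennreal" where
  "gauss_moment I j = (\<integral>\<^sup>+x. ennreal (coord_sq I x ^ j * exp (- (norm x)\<^sup>2)) \<partial>(lborel :: (real^'n) measure))"

lemma coord_sq_nonneg [simp]: "0 \<le> coord_sq I x"
  by (simp add: coord_sq_def sum_nonneg)

lemma coord_sq_UNIV: "coord_sq UNIV x = (norm x)\<^sup>2"
  by (simp add: coord_sq_def norm_vec_def L2_set_def sum_nonneg)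

lemma coord_sq_Compl: "coord_sq (- I) x = (norm x)\<^sup>2 - coord_sq I x" for x :: "real^'n"
proof -
  have "coord_sq I x + coord_sq (- I) x = coord_sq UNIV x"
    unfolding coord_sq_def by (subst sum.union_disjoint[symmetric]) auto
  then show ?thesis by (simp add: coord_sq_UNIV)
qed

lemma coord_sq_le: "coord_sq I x \<le> (norm x)\<^sup>2" for x :: "real^'n"
  unfolding coord_sq_UNIV[symmetric] coord_sq_def by (intro sum_mono2) auto

lemma coord_sq_scaleR: "coord_sq I (c *\<^sub>R x) = c\<^sup>2 * coord_sq I x"
  by (simp add: coord_sq_def power_mult_distrib sum_distrib_left)

lemma measurable_coord_sq [measurable]: "coord_sq (I :: 'n set) \<in> borel_measurable (borel :: (real^'n) measure)"
  unfolding coord_sq_def[abs_def]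
  by (intro borel_measurable_continuous_onI continuous_intros)

text \<open>The exponential tilt is absorbed into the Gaussian by dilating the coordinates in
  \<open>I\<close>. The Jacobian accounts for card I / 2 in the exponent, the factor
  \<open>coord_sq I x ^ j\<close> for j.\<close>

lemma gauss_moment_exp_scale:
  fixes I :: "'n::finite set"
  assumes s: "0 < s" "s < 1"
  shows "(\<integral>\<^sup>+x. ennreal (coord_sq I x ^ j * exp (s * coord_sq I x - (norm x)\<^sup>2)) \<partial>(lborel :: (real^'n) measure))
    = ennreal ((1 - s) powr (- (real (card I) / 2 + real j))) * gauss_moment I j"
proof -
  \<comment> \<open>Dilation by (1 - s)^(-1/2) on \<open>I\<close> turns (1 - s) times the squared
    \<open>I\<close>-part of the norm back into the untilted one.\<close>
  define c :: "'n \<Rightarrow> real" where "c i = (if i \<in> I then inverse (sqrt (1 - s)) else 1)" for i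
  define T :: "real^'n \<Rightarrow> real^'n" where "T x = (\<chi> i. c i * x $ i)" for x
  have c2: "(c i)\<^sup>2 = (if i \<in> I then 1 / (1 - s) else 1)" for i
    using s by (simp add: c_def power_divide inverse_eq_divide)
  have cT: "coord_sq J (T x) = (\<Sum>i\<in>J. (c i)\<^sup>2 * (x $ i)\<^sup>2)" for J x
    by (simp add: coord_sq_def T_def power_mult_distrib)
  have qT: "coord_sq I (T x) = coord_sq I x / (1 - s)" for x
    unfolding cT c2 by (simp add: coord_sq_def sum_divide_distrib)
  have qT': "coord_sq (- I) (T x) = coord_sq (- I) x" for x
    unfolding cT c2 by (simp add: coord_sq_def)
  have nT: "(norm (T x))\<^sup>2 = (norm x)\<^sup>2 - coord_sq I x + coord_sq I x / (1 - s)" for x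
    using coord_sq_Compl[of I "T x"] coord_sq_Compl[of I x] qT[of x] qT'[of x] by simp
  have e: "s * coord_sq I (T x) - (norm (T x))\<^sup>2 = - (norm x)\<^sup>2" for x
  proof -
    have "s * (coord_sq I x / (1 - s)) - coord_sq I x / (1 - s) = - ((1 - s) * (coord_sq I x / (1 - s)))"
      unfolding left_diff_distrib by simp
    also have "\<dots> = - coord_sq I x" using s by simp
    finally show ?thesis unfolding nT qT by simp
  qed
  have prod: "(\<Prod>i\<in>UNIV. \<bar>c i\<bar>) = (1 - s) powr (- (real (card I) / 2))"
  proof -
    have "(\<Prod>i\<in>UNIV. \<bar>c i\<bar>) = (\<Prod>i\<in>UNIV. if i \<in> I then inverse (sqrt (1 - s)) else 1)"
      using s by (intro prod.cong) (auto simp: c_def)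
    also have "\<dots> = inverse (sqrt (1 - s) ^ card I)"
      by (simp add: prod.If_cases power_inverse)
    also have "sqrt (1 - s) ^ card I = ((1 - s) powr (1/2)) powr real (card I)"
      using s by (simp add: powr_half_sqrt powr_realpow)
    also have "inverse \<dots> = (1 - s) powr (- (real (card I) / 2))"
      by (simp add: powr_powr powr_minus)
    finally show ?thesis .
  qed
  have "(\<integral>\<^sup>+x. ennreal (coord_sq I x ^ j * exp (s * coord_sq I x - (norm x)\<^sup>2)) \<partial>(lborel :: (real^'n) measure))
    = ennreal (\<Prod>i\<in>UNIV. \<bar>c i\<bar>) *
      (\<integral>\<^sup>+x. ennreal (coord_sq I (T x) ^ j * exp (s * coord_sq I (T x) - (norm (T x))\<^sup>2)) \<partial>lborel)"
    unfolding T_def using s by (intro nn_integral_lborel_scale_coordinates) (auto simp: c_def)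
  also have "(\<integral>\<^sup>+x. ennreal (coord_sq I (T x) ^ j * exp (s * coord_sq I (T x) - (norm (T x))\<^sup>2)) \<partial>lborel)
    = (\<integral>\<^sup>+x. ennreal ((1 - s) powr (- real j)) * ennreal (coord_sq I x ^ j * exp (- (norm x)\<^sup>2)) \<partial>lborel)"
    unfolding e unfolding qT using s
    by (intro nn_integral_cong)
       (simp add: ennreal_mult'[symmetric] power_divide powr_minus powr_realpow divide_inverse
        power_mult_distrib power_inverse mult_ac)
  also have "\<dots> = ennreal ((1 - s) powr (- real j)) * gauss_moment I j"
    unfolding gauss_moment_def by (rule nn_integral_cmult) measurable
  also have "ennreal (\<Prod>i\<in>UNIV. \<bar>c i\<bar>) * (ennreal ((1 - s) powr (- real j)) * gauss_moment I j)
    = ennreal ((1 - s) powr (- (real (card I) / 2 + real j))) * gauss_moment I j"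
    unfolding prod by (simp add: mult.assoc[symmetric] ennreal_mult[symmetric] powr_add[symmetric])
  finally show ?thesis .
qed

text \<open>Inserts 1 + s q \<le> exp (s q) under the integral of the scaling identity. Besides the
  recursion, this also yields finiteness of the moments.\<close>

lemma gauss_moment_lower:
  fixes I :: "'n::finite set"
  assumes s: "0 < s" "s < 1"
  shows "gauss_moment I j + ennreal s * gauss_moment I (Suc j)
    \<le> ennreal ((1 - s) powr (- (real (card I) / 2 + real j))) * gauss_moment I j"
proof -
  have "gauss_moment I j + ennreal s * gauss_moment I (Suc j)
    = (\<integral>\<^sup>+x. ennreal (coord_sq I x ^ j * exp (- (norm x)\<^sup>2))
        + ennreal s * ennreal (coord_sq I x ^ Suc j * exp (- (norm x)\<^sup>2)) \<partial>(lborel :: (real^'n) measure))"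
    unfolding gauss_moment_def by (simp add: nn_integral_add nn_integral_cmult)
  also have "\<dots> \<le> (\<integral>\<^sup>+x. ennreal (coord_sq I x ^ j * exp (s * coord_sq I x - (norm x)\<^sup>2)) \<partial>lborel)"
  proof (rule nn_integral_mono)
    fix x :: "real^'n"
    let ?q = "coord_sq I x"
    have "(?q ^ j * exp (- (norm x)\<^sup>2)) * (1 + s * ?q) \<le> (?q ^ j * exp (- (norm x)\<^sup>2)) * exp (s * ?q)"
      by (intro mult_left_mono exp_ge_add_one_self) auto
    also have "\<dots> = ?q ^ j * exp (s * ?q - (norm x)\<^sup>2)" by (simp add: exp_diff exp_minus divide_inverse)
    finally show "ennreal (?q ^ j * exp (- (norm x)\<^sup>2)) + ennreal s * ennreal (?q ^ Suc j * exp (- (norm x)\<^sup>2))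
        \<le> ennreal (?q ^ j * exp (s * ?q - (norm x)\<^sup>2))"
      using s by (simp add: ennreal_mult[symmetric] ennreal_plus[symmetric] algebra_simps del: ennreal_plus)
  qed
  finally show ?thesis unfolding gauss_moment_exp_scale[OF s] .
qed

text \<open>Inserts exp (s q) \<le> 1 + s q exp (s q), which is 1 - s q \<le> exp (- s q) multiplied
  by exp (s q). The remainder is a tilted moment of order j + 1, so the scaling identity applies to
  it too.\<close>

lemma gauss_moment_upper:
  fixes I :: "'n::finite set"
  assumes s: "0 < s" "s < 1"
  shows "ennreal ((1 - s) powr (- (real (card I) / 2 + real j))) * gauss_moment I j
    \<le> gauss_moment I j + ennreal s * (ennreal ((1 - s) powr (- (real (card I) / 2 + real (Suc j)))) * gauss_moment I (Suc j))"
proof -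
  have "(\<integral>\<^sup>+x. ennreal (coord_sq I x ^ j * exp (s * coord_sq I x - (norm x)\<^sup>2)) \<partial>(lborel :: (real^'n) measure))
    \<le> (\<integral>\<^sup>+x. ennreal (coord_sq I x ^ j * exp (- (norm x)\<^sup>2))
        + ennreal s * ennreal (coord_sq I x ^ Suc j * exp (s * coord_sq I x - (norm x)\<^sup>2)) \<partial>lborel)"
  proof (rule nn_integral_mono)
    fix x :: "real^'n"
    let ?q = "coord_sq I x"
    have "1 - s * ?q \<le> exp (- (s * ?q))" using exp_ge_add_one_self[of "- (s * ?q)"] by simp
    then have "(1 - s * ?q) * exp (s * ?q) \<le> exp (- (s * ?q)) * exp (s * ?q)"
      by (intro mult_right_mono) auto
    then have "exp (s * ?q) \<le> 1 + s * ?q * exp (s * ?q)"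
      by (simp add: exp_minus algebra_simps)
    then have "(?q ^ j * exp (- (norm x)\<^sup>2)) * exp (s * ?q)
        \<le> (?q ^ j * exp (- (norm x)\<^sup>2)) * (1 + s * ?q * exp (s * ?q))"
      by (intro mult_left_mono) auto
    moreover have "exp (s * ?q - (norm x)\<^sup>2) = exp (- (norm x)\<^sup>2) * exp (s * ?q)"
      by (simp add: exp_diff exp_minus divide_inverse)
    ultimately show "ennreal (?q ^ j * exp (s * ?q - (norm x)\<^sup>2))
        \<le> ennreal (?q ^ j * exp (- (norm x)\<^sup>2)) + ennreal s * ennreal (?q ^ Suc j * exp (s * ?q - (norm x)\<^sup>2))"
      using s by (simp add: ennreal_mult[symmetric] ennreal_plus[symmetric] algebra_simps del: ennreal_plus)
  qed
  also have "\<dots> = gauss_moment I j + ennreal s *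
      (\<integral>\<^sup>+x. ennreal (coord_sq I x ^ Suc j * exp (s * coord_sq I x - (norm x)\<^sup>2)) \<partial>(lborel :: (real^'n) measure))"
    unfolding gauss_moment_def by (simp add: nn_integral_add nn_integral_cmult)
  finally show ?thesis unfolding gauss_moment_exp_scale[OF s] .
qed

lemma gauss_moment_0: "gauss_moment (I :: 'n::finite set) 0 = gauss_moment (UNIV :: 'n set) 0"
  by (simp add: gauss_moment_def)

lemma gauss_moment_0_finite: "gauss_moment (I :: 'n::finite set) 0 \<noteq> \<top>"
proof -
  have one: "(\<integral>\<^sup>+t. ennreal (exp (- t\<^sup>2)) \<partial>lborel) < \<top>"
  proof -
    \<comment> \<open>One coordinate suffices, as the Gaussian factorises; exp (- t^2) is at most
      exp (- t^2 / 2), a multiple of the standard normal density.\<close>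
    have "(\<integral>\<^sup>+t. ennreal (exp (- t\<^sup>2)) \<partial>lborel) \<le> (\<integral>\<^sup>+t. ennreal (sqrt (2 * pi)) * ennreal (std_normal_density t) \<partial>lborel)"
    proof (rule nn_integral_mono)
      fix t :: real
      have "sqrt (2 * pi) * std_normal_density t = exp (- t\<^sup>2 / 2)"
        unfolding std_normal_density_def by (simp only: mult.assoc[symmetric]) simp
      moreover have "exp (- t\<^sup>2) \<le> exp (- t\<^sup>2 / 2)" by simp
      ultimately show "ennreal (exp (- t\<^sup>2)) \<le> ennreal (sqrt (2 * pi)) * ennreal (std_normal_density t)"
        by (metis ennreal_leI ennreal_mult' pi_ge_zero real_sqrt_ge_zero mult_nonneg_nonneg zero_le_numeral)
    qed
    also have "\<dots> = ennreal (sqrt (2 * pi)) * (\<integral>\<^sup>+t. ennreal (std_normal_density t) \<partial>lborel)"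
      by (intro nn_integral_cmult) measurable
    also have "(\<integral>\<^sup>+t. ennreal (std_normal_density t) \<partial>lborel) = 1"
      by (subst nn_integral_eq_integral) auto
    finally show ?thesis by (simp add: le_less_trans)
  qed
  have norm_Basis_sq: "(norm x)\<^sup>2 = (\<Sum>b\<in>Basis. (x \<bullet> b)\<^sup>2)" for x :: "real^'n"
    by (subst power2_norm_eq_inner, subst euclidean_inner) (simp add: power2_eq_square)
  have "gauss_moment I 0 = (\<integral>\<^sup>+x. (\<Prod>b\<in>Basis. ennreal (exp (- (x \<bullet> b)\<^sup>2))) \<partial>(lborel :: (real^'n) measure))"
    unfolding gauss_moment_def
  proof (rule nn_integral_cong)
    fix x :: "real^'n"
    have "(\<Prod>b\<in>Basis. ennreal (exp (- (x \<bullet> b)\<^sup>2))) = ennreal (exp (\<Sum>b\<in>Basis. - (x \<bullet> b)\<^sup>2))"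
      by (subst exp_sum) (auto simp: prod_ennreal)
    then show "ennreal (coord_sq I x ^ 0 * exp (- (norm x)\<^sup>2)) = (\<Prod>b\<in>Basis. ennreal (exp (- (x \<bullet> b)\<^sup>2)))"
      unfolding norm_Basis_sq by (simp add: sum_negf)
  qed
  also have "\<dots> = (\<Prod>b\<in>(Basis :: (real^'n) set). \<integral>\<^sup>+t. ennreal (exp (- t\<^sup>2)) \<partial>lborel)"
    by (rule nn_integral_lborel_prod) auto
  also have "\<dots> < \<top>" using one by (simp add: power_less_top_ennreal)
  finally show ?thesis by simp
qed

text \<open>The integrand is at least exp (- 1) on the unit ball, which has positive volume.\<close>

lemma gauss_moment_0_pos: "gauss_moment (I :: 'n::finite set) 0 \<noteq> 0"
proof -
  have "ennreal (exp (- 1)) * emeasure lborel (ball 0 1 :: (real^'n) set)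
      = (\<integral>\<^sup>+x. ennreal (exp (- 1)) * indicator (ball 0 1) x \<partial>(lborel :: (real^'n) measure))"
    by (simp add: nn_integral_cmult_indicator)
  also have "\<dots> \<le> gauss_moment I 0"
    unfolding gauss_moment_def
  proof (rule nn_integral_mono)
    fix x :: "real^'n"
    have "(norm x)\<^sup>2 \<le> 1" if "norm x < 1" using that by (simp add: power_le_one)
    then show "ennreal (exp (- 1)) * indicator (ball 0 1) x \<le> ennreal (coord_sq I x ^ 0 * exp (- (norm x)\<^sup>2))"
      by (auto simp: indicator_def intro!: ennreal_leI)
  qed
  finally show ?thesis using unit_ball_emeasure(1)[where 'a="real^'n"] by auto
qed

text \<open>Induction: the lower bound at s = 1/2 controls each moment by a finite multiple of the
  preceding one.\<close>

lemma gauss_moment_finite: "gauss_moment (I :: 'n::finite set) j \<noteq> \<top>"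
proof (induction j)
  case (Suc j)
  have "ennreal (1/2) * gauss_moment I (Suc j)
      \<le> ennreal ((1 - 1/2) powr (- (real (card I) / 2 + real j))) * gauss_moment I j"
    by (rule order_trans[OF _ gauss_moment_lower]) (auto intro!: add_increasing)
  also have "\<dots> < \<top>" using Suc by (simp add: ennreal_mult_less_top less_top)
  finally show ?case by (auto simp: ennreal_mult_less_top)
qed (rule gauss_moment_0_finite)

text \<open>
  Differentiating the scaling identity of \<open>gauss_moment_exp_scale\<close> at s = 0, with
  1 + s q \<le> exp (s q) \<le> 1 + s q exp (s q) in place of a dominated convergence argument.
\<close>

lemma gauss_moment_Suc:
  fixes I :: "'n::finite set"
  shows "enn2real (gauss_moment I (Suc j)) = (real (card I) / 2 + real j) * enn2real (gauss_moment I j)"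
proof -
  define b where "b = real (card I) / 2 + real j"
  define g h where "g = enn2real (gauss_moment I j)" and "h = enn2real (gauss_moment I (Suc j))"
  have gh: "gauss_moment I j = ennreal g" "gauss_moment I (Suc j) = ennreal h" "g \<ge> 0" "h \<ge> 0"
    using gauss_moment_finite[of I] by (auto simp: g_def h_def less_top)
  have Suc_b: "real (card I) / 2 + real (Suc j) = b + 1" by (simp add: b_def)
  have lower: "h \<le> ((1 - s) powr (- b) - 1) / s * g" if s: "0 < s" "s < 1" for s
  proof -
    have "ennreal (g + s * h) \<le> ennreal ((1 - s) powr (- b) * g)"
      using gauss_moment_lower[OF s, of I j, folded b_def] gh(3,4) s
      unfolding gh(1,2) by (simp add: ennreal_mult)
    then have "g + s * h \<le> (1 - s) powr (- b) * g"
      using gh(3,4) by (subst (asm) ennreal_le_iff) auto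
    then have "h * s \<le> ((1 - s) powr (- b) - 1) * g" by (simp add: algebra_simps)
    then show ?thesis using s by (simp add: pos_le_divide_eq)
  qed
  have upper: "((1 - s) powr (- b) - 1) / s * g \<le> (1 - s) powr (- (b + 1)) * h" if s: "0 < s" "s < 1" for s
  proof -
    have "ennreal ((1 - s) powr (- b) * g) \<le> ennreal (g + s * ((1 - s) powr (- (b + 1)) * h))"
      using gauss_moment_upper[OF s, of I j, folded b_def] gh(3,4) s
      unfolding gh(1,2) Suc_b by (simp add: ennreal_mult)
    then have "(1 - s) powr (- b) * g \<le> g + s * ((1 - s) powr (- (b + 1)) * h)"
      using gh(3,4) s by (subst (asm) ennreal_le_iff) auto
    then have "((1 - s) powr (- b) - 1) * g \<le> (1 - s) powr (- (b + 1)) * h * s"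
      by (simp add: algebra_simps)
    then show ?thesis using s by (simp add: pos_divide_le_eq)
  qed
  have ev: "\<forall>\<^sub>F s in at_right 0. 0 < s \<and> s < (1::real)"
    by (auto simp: eventually_at_right_field intro: exI[of _ 1])
  \<comment> \<open>The quotient in \<open>lower\<close> and \<open>upper\<close> is a difference
    quotient at 0 with limit b. Only the limit from the right is taken, as the bounds hold for 0 < s
    < 1.\<close>
  have "((\<lambda>s. (1 - s) powr (- b)) has_real_derivative b) (at 0)"
    by (auto intro!: derivative_eq_intros)
  then have "((\<lambda>s. ((1 - s) powr (- b) - 1) / s) \<longlongrightarrow> b) (at 0)"
    unfolding has_field_derivative_iff by simp
  then have "((\<lambda>s. ((1 - s) powr (- b) - 1) / s) \<longlongrightarrow> b) (at_right 0)"
    by (rule tendsto_within_subset) simp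
  then have lim: "((\<lambda>s. ((1 - s) powr (- b) - 1) / s * g) \<longlongrightarrow> b * g) (at_right 0)"
    by (intro tendsto_intros)
  have "((\<lambda>s::real. (1 - s) powr (- (b + 1)) * h) \<longlongrightarrow> (1 - 0) powr (- (b + 1)) * h) (at_right 0)"
    by (intro tendsto_intros) auto
  then have lim': "((\<lambda>s::real. (1 - s) powr (- (b + 1)) * h) \<longlongrightarrow> h) (at_right 0)" by simp
  have "h \<le> b * g"
  proof (rule tendsto_lowerbound[OF lim])
    show "\<forall>\<^sub>F s in at_right 0. h \<le> ((1 - s) powr (- b) - 1) / s * g"
      using ev by (rule eventually_mono) (use lower in blast)
  qed simp
  moreover have "b * g \<le> h"
  proof (rule tendsto_le[OF _ lim' lim])
    show "\<forall>\<^sub>F s in at_right 0. ((1 - s) powr (- b) - 1) / s * g \<le> (1 - s) powr (- (b + 1)) * h"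
      using ev by (rule eventually_mono) (use upper in blast)
  qed simp
  ultimately show ?thesis by (simp add: b_def g_def h_def)
qed

section \<open>Sub-Gaussian concentration\<close>

lemma gauss_moment_UNIV_pos: "enn2real (gauss_moment (UNIV :: 'n::finite set) j) > 0"
proof (induction j)
  case 0
  show ?case
    using gauss_moment_0_pos[of "UNIV :: 'n set"] gauss_moment_0_finite[of "UNIV :: 'n set"]
    by (simp add: enn2real_positive_iff less_top zero_less_iff_neq_zero)
next
  case (Suc j)
  then show ?case unfolding gauss_moment_Suc by (intro mult_pos_pos add_pos_nonneg) auto
qed

lemma gauss_moment_le_UNIV: "gauss_moment (I :: 'n::finite set) j \<le> gauss_moment (UNIV :: 'n set) j"
  unfolding gauss_moment_def
proof (rule nn_integral_mono)
  fix x :: "real^'n"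
  show "ennreal (coord_sq I x ^ j * exp (- (norm x)\<^sup>2)) \<le> ennreal (coord_sq UNIV x ^ j * exp (- (norm x)\<^sup>2))"
    by (intro ennreal_leI mult_right_mono power_mono) (simp_all add: coord_sq_UNIV coord_sq_le)
qed

text \<open>Writing x as direction times radius factorises the Gaussian moment into the spherical
  moment and a radial integral; the latter is the Gaussian moment of the full squared norm.\<close>

lemma nn_integral_sphere_moment:
  fixes I :: "'n::finite set"
  shows "(\<integral>\<^sup>+v. ennreal (coord_sq I v ^ j) \<partial>unif_sphere)
    = ennreal (enn2real (gauss_moment I j) / enn2real (gauss_moment (UNIV :: 'n set) j))"
proof -
  interpret S: prob_space "unif_sphere :: (real^'n) measure" by (rule prob_space_unif_sphere)
  let ?m = "\<integral>\<^sup>+v. ennreal (coord_sq I v ^ j) \<partial>unif_sphere"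
  \<comment> \<open>Squared coordinate norms are at most 1 on the sphere; this supplies the
    finiteness required for the polar factorisation.\<close>
  have "?m \<le> (\<integral>\<^sup>+v. 1 \<partial>(unif_sphere :: (real^'n) measure))"
  proof (rule nn_integral_mono_AE)
    show "AE v in unif_sphere. ennreal (coord_sq I v ^ j) \<le> 1"
      using AE_unif_sphere_norm
    proof (rule AE_mp, intro AE_I2 impI)
      fix v :: "real^'n" assume "norm v = 1"
      then have "coord_sq I v \<le> 1" using coord_sq_le[of I v] by simp
      then show "ennreal (coord_sq I v ^ j) \<le> 1" by (simp add: power_le_one)
    qed
  qed
  then have "?m \<le> 1" using S.emeasure_space_1 by simp
  then have fin: "?m \<noteq> \<top>" by (auto simp: top_unique)
  then obtain m where m: "?m = ennreal m" "m \<ge> 0" by (cases ?m) auto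
  have "gauss_moment I j
      = (\<integral>\<^sup>+x. ennreal (coord_sq I (x /\<^sub>R norm x) ^ j) * ennreal (((norm x)\<^sup>2) ^ j * exp (- (norm x)\<^sup>2)) \<partial>lborel)"
    unfolding gauss_moment_def
  proof (rule nn_integral_cong)
    fix x :: "real^'n"
    have "coord_sq I x = coord_sq I (x /\<^sub>R norm x) * (norm x)\<^sup>2"
    proof (cases "x = 0")
      case True
      then show ?thesis by (simp add: coord_sq_def)
    next
      case False
      then show ?thesis by (simp add: coord_sq_scaleR power_inverse)
    qed
    then show "ennreal (coord_sq I x ^ j * exp (- (norm x)\<^sup>2))
        = ennreal (coord_sq I (x /\<^sub>R norm x) ^ j) * ennreal (((norm x)\<^sup>2) ^ j * exp (- (norm x)\<^sup>2))"
      by (metis coord_sq_nonneg ennreal_mult' mult.assoc power_mult_distrib zero_le_power)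
  qed
  also have "\<dots> = ?m * (\<integral>\<^sup>+x. ennreal (((norm x)\<^sup>2) ^ j * exp (- (norm x)\<^sup>2)) \<partial>(lborel :: (real^'n) measure))"
    by (rule nn_integral_polar[where g = "\<lambda>r. ennreal ((r\<^sup>2) ^ j * exp (- r\<^sup>2))"]) (use fin in auto)
  also have "\<dots> = ?m * gauss_moment (UNIV :: 'n set) j" by (simp add: gauss_moment_def coord_sq_UNIV)
  finally have "enn2real (gauss_moment I j) = m * enn2real (gauss_moment (UNIV :: 'n set) j)"
    using m by (simp add: enn2real_mult)
  then show ?thesis using m gauss_moment_UNIV_pos[of j, where 'n='n] by simp
qed

lemma nn_integral_exp_coord_sq_le:
  fixes I :: "'n::finite set"
  assumes l: "l \<ge> 0"
  shows "(\<integral>\<^sup>+v. ennreal (exp (l * coord_sq I v)) \<partial>unif_sphere)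
    \<le> ennreal (exp (l * (real (card I) / real CARD('n)) + l\<^sup>2 / (4 * (real CARD('n) + 2))))"
proof -
  define m where "m j = enn2real (gauss_moment I j) / enn2real (gauss_moment (UNIV :: 'n set) j)" for j
  have sphere_moment: "(\<integral>\<^sup>+v. ennreal (coord_sq I v ^ j) \<partial>unif_sphere) = ennreal (m j)" for j
    unfolding m_def by (rule nn_integral_sphere_moment)
  have U: "enn2real (gauss_moment (UNIV :: 'n set) j) > 0" for j by (rule gauss_moment_UNIV_pos)
  have m0: "m 0 = 1" unfolding m_def gauss_moment_0[of I] using U[of 0] by simp
  have m_nonneg: "0 \<le> m j" for j by (simp add: m_def)
  have m_le: "m j \<le> 1" for j
    using enn2real_mono[OF gauss_moment_le_UNIV[of I j]] gauss_moment_finite[of "UNIV :: 'n set" j] U[of j]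
    by (simp add: m_def less_top)
  \<comment> \<open>The Beta recursion arises as the quotient of the Gamma recursions for
    \<open>I\<close> and for \<open>UNIV\<close>.\<close>
  have rec: "(real CARD('n) / 2 + real j) * m (Suc j) = (real (card I) / 2 + real j) * m j" for j
  proof -
    have "real CARD('n) / 2 + real j > 0" by (simp add: add_pos_nonneg)
    then show ?thesis using U[of j] unfolding m_def gauss_moment_Suc by simp
  qed
  have "(\<integral>\<^sup>+v. ennreal (exp (l * coord_sq I v)) \<partial>unif_sphere)
      = (\<integral>\<^sup>+v. (\<Sum>j. ennreal (l ^ j / fact j) * ennreal (coord_sq I v ^ j)) \<partial>unif_sphere)"
  proof (rule nn_integral_cong)
    fix v :: "real^'n"
    have "(\<lambda>j. (l * coord_sq I v) ^ j /\<^sub>R fact j) sums exp (l * coord_sq I v)" by (rule exp_converges)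
    then have "(\<lambda>j. (l ^ j / fact j) * (coord_sq I v ^ j)) sums exp (l * coord_sq I v)"
      by (simp add: power_mult_distrib divide_inverse mult_ac)
    then show "ennreal (exp (l * coord_sq I v)) = (\<Sum>j. ennreal (l ^ j / fact j) * ennreal (coord_sq I v ^ j))"
      using l by (simp add: ennreal_mult'[symmetric] suminf_ennreal2 sums_iff)
  qed
  \<comment> \<open>Termwise integration is monotone convergence: all terms are nonnegative because
    l \<ge> 0.\<close>
  also have "\<dots> = (\<Sum>j. ennreal (l ^ j / fact j) * (\<integral>\<^sup>+v. ennreal (coord_sq I v ^ j) \<partial>unif_sphere))"
    by (simp add: nn_integral_suminf nn_integral_cmult)
  also have "\<dots> = (\<Sum>j. ennreal (m j / fact j * l ^ j))"
    using l by (simp add: sphere_moment m_nonneg ennreal_mult'[symmetric] mult_ac)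
  also have "\<dots> = ennreal (\<Sum>j. m j / fact j * l ^ j)"
    using summable_shifted_moments[of m 0 l] m_nonneg m_le l by (intro suminf_ennreal2) auto
  also have "(\<Sum>j. m j / fact j * l ^ j)
      \<le> exp ((real (card I) / 2) / (real CARD('n) / 2) * l + l\<^sup>2 / (8 * (real CARD('n) / 2 + 1)))"
    by (rule kummer_series_le_gaussian[OF m0 m_nonneg m_le rec _ l]) simp
  also have "(real (card I) / 2) / (real CARD('n) / 2) * l + l\<^sup>2 / (8 * (real CARD('n) / 2 + 1))
      = l * (real (card I) / real CARD('n)) + l\<^sup>2 / (4 * (real CARD('n) + 2))"
    by (simp add: algebra_simps)
  finally show ?thesis by (simp add: ennreal_leI)
qed

text \<open>For negative \<open>l\<close> pass to the complement of \<open>I\<close>: on the sphere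
  the two squared norms add up to 1, so the centred variable only changes sign.\<close>

lemma nn_integral_exp_centered_coord_sq_le:
  fixes I :: "'n::finite set"
  shows "(\<integral>\<^sup>+v. ennreal (exp (l * (coord_sq I v - real (card I) / real CARD('n)))) \<partial>unif_sphere)
    \<le> ennreal (exp (l\<^sup>2 / (4 * (real CARD('n) + 2))))"
proof -
  have *: "(\<integral>\<^sup>+v. ennreal (exp (l * (coord_sq I v - real (card I) / real CARD('n)))) \<partial>unif_sphere)
    \<le> ennreal (exp (l\<^sup>2 / (4 * (real CARD('n) + 2))))" if l: "l \<ge> 0" for l and I :: "'n set"
  proof -
    let ?k = "real (card I) / real CARD('n)"
    have "(\<integral>\<^sup>+v. ennreal (exp (l * (coord_sq I v - ?k))) \<partial>unif_sphere)
      = (\<integral>\<^sup>+v. ennreal (exp (- (l * ?k))) * ennreal (exp (l * coord_sq I v)) \<partial>unif_sphere)"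
      by (intro nn_integral_cong)
         (simp only: ennreal_mult'[symmetric] exp_ge_zero exp_add[symmetric] right_diff_distrib
           minus_add_distrib add.commute[of "- _"] add_uminus_conv_diff)
    also have "\<dots> = ennreal (exp (- (l * ?k))) * (\<integral>\<^sup>+v. ennreal (exp (l * coord_sq I v)) \<partial>unif_sphere)"
      by (intro nn_integral_cmult) measurable
    also have "\<dots> \<le> ennreal (exp (- (l * ?k))) * ennreal (exp (l * ?k + l\<^sup>2 / (4 * (real CARD('n) + 2))))"
      by (intro mult_left_mono nn_integral_exp_coord_sq_le l) auto
    also have "\<dots> = ennreal (exp (l\<^sup>2 / (4 * (real CARD('n) + 2))))"
      by (simp add: ennreal_mult'[symmetric] exp_add[symmetric])
    finally show ?thesis .
  qed
  show ?thesis
  proof (cases "l \<ge> 0")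
    case False
    have "(\<integral>\<^sup>+v. ennreal (exp (l * (coord_sq I v - real (card I) / real CARD('n)))) \<partial>unif_sphere)
      = (\<integral>\<^sup>+v. ennreal (exp (- l * (coord_sq (- I) v - real (card (- I)) / real CARD('n)))) \<partial>unif_sphere)"
    proof (rule nn_integral_cong_AE, rule AE_mp[OF AE_unif_sphere_norm], intro AE_I2 impI)
      fix v :: "real^'n" assume "norm v = 1"
      moreover have "real (card (- I)) = real CARD('n) - real (card I)"
        by (simp add: Compl_eq_Diff_UNIV card_Diff_subset of_nat_diff card_mono)
      ultimately have "coord_sq (- I) v - real (card (- I)) / real CARD('n)
          = - (coord_sq I v - real (card I) / real CARD('n))"
        by (simp add: coord_sq_Compl diff_divide_distrib)
      then show "ennreal (exp (l * (coord_sq I v - real (card I) / real CARD('n))))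
          = ennreal (exp (- l * (coord_sq (- I) v - real (card (- I)) / real CARD('n))))"
        by (simp only: minus_mult_minus)
    qed
    also have "\<dots> \<le> ennreal (exp ((- l)\<^sup>2 / (4 * (real CARD('n) + 2))))"
      using False by (intro *) simp
    finally show ?thesis by simp
  qed (rule *)
qed

text \<open>The map from a vector to its coordinates in the frame \<open>q\<close> is orthogonal by
  Parseval, so rotation invariance reduces the claim to standard coordinates.\<close>

lemma nn_integral_exp_centered_frame_le:
  fixes q :: "'n \<Rightarrow> real^'n"
  assumes q: "\<And>i j. q i \<bullet> q j = (if i = j then 1 else 0)"
  shows "(\<integral>\<^sup>+v. ennreal (exp (l * ((\<Sum>i\<in>I. (q i \<bullet> v)\<^sup>2) - real (card I) / real CARD('n)))) \<partial>unif_sphere)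
    \<le> ennreal (exp (l\<^sup>2 / (4 * (real CARD('n) + 2))))"
proof -
  define R :: "real^'n \<Rightarrow> real^'n" where "R v = (\<chi> i. q i \<bullet> v)" for v
  have "linear R" by (rule linearI) (simp_all add: R_def vec_eq_iff inner_add_right)
  moreover have "norm (R v) = norm v" for v
  proof -
    have "(norm (R v))\<^sup>2 = (norm v)\<^sup>2"
      by (simp add: coord_sq_UNIV[symmetric] coord_sq_def R_def orthonormal_family_parseval[OF q])
    then show ?thesis by simp
  qed
  ultimately have R: "orthogonal_transformation R" by (simp add: orthogonal_transformation)
  have "(\<integral>\<^sup>+v. ennreal (exp (l * (coord_sq I (R v) - real (card I) / real CARD('n)))) \<partial>unif_sphere)
      = (\<integral>\<^sup>+v. ennreal (exp (l * (coord_sq I v - real (card I) / real CARD('n)))) \<partial>unif_sphere)"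
    by (rule nn_integral_unif_sphere_orthogonal_transformation[OF R]) measurable
  also have "\<dots> \<le> ennreal (exp (l\<^sup>2 / (4 * (real CARD('n) + 2))))"
    by (rule nn_integral_exp_centered_coord_sq_le)
  finally show ?thesis by (simp add: coord_sq_def R_def)
qed

section \<open>Chernoff's bound for independent samples\<close>

lemma (in prob_space) subgaussian_sum_tail:
  fixes X :: "'i \<Rightarrow> 'a \<Rightarrow> real"
  assumes indep: "indep_vars (\<lambda>_. borel) X J" and J: "finite J" and s: "s > 0" and t: "t > 0"
    and mgf: "\<And>i. i \<in> J \<Longrightarrow> (\<integral>\<^sup>+\<omega>. ennreal (exp (2 * s * t * X i \<omega>)) \<partial>M) \<le> ennreal (exp (s * t\<^sup>2))"
  shows "prob {\<omega> \<in> space M. (\<Sum>i\<in>J. X i \<omega>) \<ge> real (card J) * t} \<le> exp (- real (card J) * s * t\<^sup>2)"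
proof -
  have [measurable]: "X i \<in> borel_measurable M" if "i \<in> J" for i
    using indep that by (auto simp: indep_vars_def)
  \<comment> \<open>The Chernoff parameter 2 s t minimises l^2 / (4 s) - l t over l, with minimum -
    s t^2.\<close>
  have "ennreal (prob {\<omega> \<in> space M. (\<Sum>i\<in>J. X i \<omega>) \<ge> real (card J) * t})
      \<le> ennreal (exp (- (2 * s * t) * (real (card J) * t))) *
        (\<integral>\<^sup>+\<omega>\<in>space M. ennreal (exp (2 * s * t * (\<Sum>i\<in>J. X i \<omega>))) \<partial>M)"
    unfolding emeasure_eq_measure[symmetric] using s t
    by (intro Chernoff_ineq_nn_integral_ge) auto
  also have "(\<integral>\<^sup>+\<omega>\<in>space M. ennreal (exp (2 * s * t * (\<Sum>i\<in>J. X i \<omega>))) \<partial>M)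
      = (\<integral>\<^sup>+\<omega>. (\<Prod>i\<in>J. ennreal (exp (2 * s * t * X i \<omega>))) \<partial>M)"
    using J by (intro nn_integral_cong) (simp add: sum_distrib_left exp_sum prod_ennreal)
  also have "\<dots> = (\<Prod>i\<in>J. \<integral>\<^sup>+\<omega>. ennreal (exp (2 * s * t * X i \<omega>)) \<partial>M)"
    by (intro indep_vars_nn_integral J indep_vars_compose2[OF indep]) auto
  also have "\<dots> \<le> (\<Prod>i\<in>J. ennreal (exp (s * t\<^sup>2)))"
    by (intro prod_mono_ennreal mgf)
  also have "\<dots> = ennreal (exp (real (card J) * (s * t\<^sup>2)))"
    by (simp add: ennreal_power exp_of_nat_mult)
  also have "ennreal (exp (- (2 * s * t) * (real (card J) * t))) * ennreal (exp (real (card J) * (s * t\<^sup>2)))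
      = ennreal (exp (- real (card J) * s * t\<^sup>2))"
    by (simp add: ennreal_mult'[symmetric] exp_add[symmetric] power2_eq_square algebra_simps)
  finally show ?thesis by (simp add: mult_left_mono)
qed

lemma (in prob_space) frame_mean_concentration:
  fixes q :: "'n \<Rightarrow> real^'n" and V :: "nat \<Rightarrow> 'a \<Rightarrow> real^'n" and I :: "'n set"
  assumes q: "\<And>i j. q i \<bullet> q j = (if i = j then 1 else 0)"
    and nv: "nv > 0" and indep: "indep_vars (\<lambda>_. borel) V {..<nv}"
    and unif: "\<And>i. i < nv \<Longrightarrow> distr M borel (V i) = unif_sphere" and t: "t > 0"
  defines "E \<equiv> {\<omega> \<in> space M. \<bar>real (card I) / real CARD('n) - (\<Sum>i<nv. \<Sum>k\<in>I. (q k \<bullet> V i \<omega>)\<^sup>2) / real nv\<bar> > t}"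
  shows "E \<in> events" and "prob E \<le> 2 * exp (- real nv * (real CARD('n) + 2) * t\<^sup>2)"
proof -
  have V[measurable]: "V i \<in> borel_measurable M" if "i < nv" for i
    using indep that by (auto simp: indep_vars_def)
  show "E \<in> events" unfolding E_def by measurable
  \<comment> \<open>The sign \<sigma> = 1 or - 1 lets one argument treat both tails; the
    sub-Gaussian estimate holds for exponents of either sign.\<close>
  define X where "X \<sigma> i \<omega> = \<sigma> * ((\<Sum>k\<in>I. (q k \<bullet> V i \<omega>)\<^sup>2) - real (card I) / real CARD('n))"
    for \<sigma> :: real and i \<omega>
  have tail: "prob {\<omega> \<in> space M. (\<Sum>i<nv. X \<sigma> i \<omega>) \<ge> real nv * t} \<le> exp (- real nv * (real CARD('n) + 2) * t\<^sup>2)"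
    if \<sigma>: "\<sigma>\<^sup>2 = 1" for \<sigma>
  proof -
    have "indep_vars (\<lambda>_. borel) (X \<sigma>) {..<nv}"
      unfolding X_def[abs_def]
      by (rule indep_vars_compose2[OF indep, where Y = "\<lambda>_ v. \<sigma> * ((\<Sum>k\<in>I. (q k \<bullet> v)\<^sup>2) - real (card I) / real CARD('n))"])
         measurable
    moreover have "(\<integral>\<^sup>+\<omega>. ennreal (exp (2 * (real CARD('n) + 2) * t * X \<sigma> i \<omega>)) \<partial>M)
        \<le> ennreal (exp ((real CARD('n) + 2) * t\<^sup>2))" if i: "i \<in> {..<nv}" for i
    proof -
      let ?l = "2 * (real CARD('n) + 2) * t * \<sigma>"
      have "(\<integral>\<^sup>+\<omega>. ennreal (exp (2 * (real CARD('n) + 2) * t * X \<sigma> i \<omega>)) \<partial>M)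
        = (\<integral>\<^sup>+v. ennreal (exp (?l * ((\<Sum>k\<in>I. (q k \<bullet> v)\<^sup>2) - real (card I) / real CARD('n)))) \<partial>distr M borel (V i))"
        using i by (subst nn_integral_distr) (auto simp: X_def mult.assoc)
      also have "\<dots> \<le> ennreal (exp (?l\<^sup>2 / (4 * (real CARD('n) + 2))))"
        using i unif nn_integral_exp_centered_frame_le[OF q] by simp
      also have "?l\<^sup>2 / (4 * (real CARD('n) + 2)) = (real CARD('n) + 2) * t\<^sup>2"
        by (simp add: power_mult_distrib \<sigma> divide_simps) (simp add: power2_eq_square algebra_simps)
      finally show ?thesis .
    qed
    ultimately show ?thesis
      using subgaussian_sum_tail[of "X \<sigma>" "{..<nv}" "real CARD('n) + 2" t] t by (simp add: mult.assoc)
  qed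
  have [measurable]: "(\<lambda>\<omega>. \<Sum>i<nv. X \<sigma> i \<omega>) \<in> borel_measurable M" for \<sigma>
    unfolding X_def by measurable
  \<comment> \<open>Multiplying the deviation by nv turns it into the absolute value of the centred
    sum, so one of the two signed sums is large.\<close>
  have "E \<subseteq> {\<omega> \<in> space M. (\<Sum>i<nv. X 1 i \<omega>) \<ge> real nv * t} \<union> {\<omega> \<in> space M. (\<Sum>i<nv. X (- 1) i \<omega>) \<ge> real nv * t}"
  proof
    fix \<omega> assume \<omega>: "\<omega> \<in> E"
    define k where "k = real (card I) / real CARD('n)"
    define Y where "Y = (\<Sum>i<nv. \<Sum>k\<in>I. (q k \<bullet> V i \<omega>)\<^sup>2)"
    have X: "(\<Sum>i<nv. X \<sigma> i \<omega>) = \<sigma> * (Y - real nv * k)" for \<sigma>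
      by (simp add: X_def Y_def k_def sum_subtractf sum_distrib_left[symmetric])
    have "t < \<bar>k - Y / real nv\<bar>" using \<omega> by (simp add: E_def k_def Y_def)
    then have "real nv * t < real nv * \<bar>k - Y / real nv\<bar>" using nv by simp
    also have "\<dots> = \<bar>real nv * (k - Y / real nv)\<bar>" by (simp add: abs_mult)
    also have "real nv * (k - Y / real nv) = real nv * k - Y" using nv by (simp add: right_diff_distrib)
    finally show "\<omega> \<in> {\<omega> \<in> space M. (\<Sum>i<nv. X 1 i \<omega>) \<ge> real nv * t} \<union> {\<omega> \<in> space M. (\<Sum>i<nv. X (- 1) i \<omega>) \<ge> real nv * t}"
      using \<omega> by (auto simp: X E_def)
  qed
  then have "prob E \<le> prob ({\<omega> \<in> space M. (\<Sum>i<nv. X 1 i \<omega>) \<ge> real nv * t}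
      \<union> {\<omega> \<in> space M. (\<Sum>i<nv. X (- 1) i \<omega>) \<ge> real nv * t})"
    by (intro finite_measure_mono) auto
  also have "\<dots> \<le> prob {\<omega> \<in> space M. (\<Sum>i<nv. X 1 i \<omega>) \<ge> real nv * t}
      + prob {\<omega> \<in> space M. (\<Sum>i<nv. X (- 1) i \<omega>) \<ge> real nv * t}"
    by (intro measure_Un_le) auto
  also have "\<dots> \<le> 2 * exp (- real nv * (real CARD('n) + 2) * t\<^sup>2)"
    using tail[of 1] tail[of "- 1"] by simp
  finally show "prob E \<le> 2 * exp (- real nv * (real CARD('n) + 2) * t\<^sup>2)" .
qed

section \<open>The pointwise and the uniform deviation bound\<close>

theorem theorem2:
  fixes A :: "real^'n^'n" and nv :: nat
    and M :: "'w measure" and V :: "nat \<Rightarrow> 'w \<Rightarrow> real^'n"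
  assumes symA: "transpose A = A"
    and nv_pos: "nv > 0"
    and P: "prob_space M"
    and indep: "prob_space.indep_vars M (\<lambda>_. borel) V {..<nv}"
    and unif: "\<And>i. i < nv \<Longrightarrow> distr M borel (V i) = unif_sphere"
  shows "(\<forall>x::real. \<forall>t::real. t > 0 \<longrightarrow>
           measure M {\<omega> \<in> space M.
              \<bar>CESM A x - (\<Sum>i<nv. wCESM A (V i \<omega>) x) / real nv\<bar> > t}
           \<le> 2 * exp (- real nv * (real CARD('n) + 2) * t\<^sup>2)) \<and>
         (\<forall>t::real. t > 0 \<longrightarrow>
           measure M {\<omega> \<in> space M.
              dKS (CESM A) (\<lambda>x. (\<Sum>i<nv. wCESM A (V i \<omega>) x) / real nv) > t}
           \<le> 2 * real CARD('n) * exp (- real nv * (real CARD('n) + 2) * t\<^sup>2))"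
proof -
  interpret prob_space M by (rule P)
  obtain q :: "'n \<Rightarrow> real^'n" and d where q: "\<And>i j. q i \<bullet> q j = (if i = j then 1 else 0)"
    and d: "\<And>i. A *v q i = d i *\<^sub>R q i"
    using symmetric_matrix_eigenbasis[OF symA] by blast
  note CESM = CESM_eq_card_eigenvalues[OF q d] and wCESM = wCESM_eq_sum_eigenbasis[OF symA q d]
  define E where "E t x = {\<omega> \<in> space M. \<bar>CESM A x - (\<Sum>i<nv. wCESM A (V i \<omega>) x) / real nv\<bar> > t}" for t x
  have E: "E t x \<in> events" "prob (E t x) \<le> 2 * exp (- real nv * (real CARD('n) + 2) * t\<^sup>2)"
    if "t > 0" for t x
    unfolding E_def CESM wCESM by (rule frame_mean_concentration[OF q nv_pos indep unif that]; assumption)+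
  have "prob {\<omega> \<in> space M. dKS (CESM A) (\<lambda>x. (\<Sum>i<nv. wCESM A (V i \<omega>) x) / real nv) > t}
      \<le> 2 * real CARD('n) * exp (- real nv * (real CARD('n) + 2) * t\<^sup>2)" if t: "t > 0" for t
  proof -
    have "{\<omega> \<in> space M. dKS (CESM A) (\<lambda>x. (\<Sum>i<nv. wCESM A (V i \<omega>) x) / real nv) > t} \<subseteq> (\<Union>i. E t (d i))"
    proof clarify
      fix \<omega> assume \<omega>: "\<omega> \<in> space M"
        and gt: "t < dKS (CESM A) (\<lambda>x. (\<Sum>i<nv. wCESM A (V i \<omega>) x) / real nv)"
      \<comment> \<open>If every pointwise difference were at most t, so would be the
        supremum.\<close>
      obtain x where x: "t < \<bar>CESM A x - (\<Sum>i<nv. wCESM A (V i \<omega>) x) / real nv\<bar>"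
      proof (rule ccontr)
        assume "\<not> thesis"
        then have "\<bar>CESM A x - (\<Sum>i<nv. wCESM A (V i \<omega>) x) / real nv\<bar> \<le> t" for x
          using that by (meson not_le)
        then have "dKS (CESM A) (\<lambda>x. (\<Sum>i<nv. wCESM A (V i \<omega>) x) / real nv) \<le> t"
          unfolding dKS_def by (intro cSUP_least) auto
        then show False using gt by simp
      qed
      \<comment> \<open>Below the smallest eigenvalue both step functions are 0, so no deviation
        above t > 0 occurs there.\<close>
      have ne: "{i. d i \<le> x} \<noteq> {}"
      proof
        assume "{i. d i \<le> x} = {}"
        then show False using x t by (simp add: CESM wCESM)
      qed
      \<comment> \<open>Neither function jumps between the largest eigenvalue at most
        \<open>x\<close> and \<open>x\<close> itself, so the deviation already occurs at that
        eigenvalue.\<close>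
      have "Max (d ` {i. d i \<le> x}) \<in> d ` {i. d i \<le> x}"
        using ne by (intro Max_in) auto
      then obtain i0 where i0: "d i0 \<le> x" "Max (d ` {i. d i \<le> x}) = d i0" by auto
      moreover have "d i \<le> d i0" if "d i \<le> x" for i
        unfolding i0(2)[symmetric] using that by (intro Max_ge) auto
      ultimately have "{i. d i \<le> x} = {i. d i \<le> d i0}" by auto
      then have "\<omega> \<in> E t (d i0)" using x \<omega> by (simp add: E_def CESM wCESM)
      then show "\<omega> \<in> (\<Union>i. E t (d i))" by blast
    qed
    \<comment> \<open>Only the union is shown to be an event. That is enough for monotonicity, since
      a set outside the sigma-algebra has \<open>measure\<close> 0.\<close>
    then have "prob {\<omega> \<in> space M. dKS (CESM A) (\<lambda>x. (\<Sum>i<nv. wCESM A (V i \<omega>) x) / real nv) > t}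
        \<le> prob (\<Union>i. E t (d i))"
      using E(1)[OF t] by (intro finite_measure_mono) auto
    also have "\<dots> \<le> (\<Sum>i\<in>UNIV. prob (E t (d i)))"
      using E(1)[OF t] by (intro finite_measure_subadditive_finite) auto
    also have "\<dots> \<le> (\<Sum>i\<in>(UNIV :: 'n set). 2 * exp (- real nv * (real CARD('n) + 2) * t\<^sup>2))"
      by (intro sum_mono E t)
    finally show ?thesis by simp
  qed
  then show ?thesis using E(2) unfolding E_def by blast
qed

end
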